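(* For $n\in\mathbb N$ let $A_n:[0,T]\times\Omega\to\mathbb R$ be a sequence of adapted stochastic processes such that $\|A_n\|_\infty\to0$ in probability as $n\to\infty$. Let $f,g:\mathbb R\to\mathbb R$ satisfy $f(0)=g(0)=0$ and suppose there is $L>0$ such that for all $x,y\in\mathbb R$ $$(x-y)(f(x)-f(y))\le L|x-y|^2,\qquad |g(x)-g(y)|\le L|x-y|.$$ Let $U_n$ be the solution of $$U_n(t)=A_n(t)+\int_0^tf(U_n(s))\,ds+\int_0^tg(U_n(s))\,dW(s),\qquad t\in[0,T].$$ Then $\|U_n\|_\infty\to0$ in probability as $n\to\infty$.
   Context: $T>0$; $(\Omega,\mathcal F,(\mathcal F_t)_{t\in[0,T]},\mathbb P)$ is a filtered probability space satisfying the usual conditions and carrying a Brownian motion $W$ (one-dimensional here); $\|Y\|_\infty=\sup_{t\in[0,T]}|Y(t)|$. *)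

theory Defs
  imports "HOL-Probability.Probability"
begin

text \<open>
  Processes are functions \<open>X :: real \<Rightarrow> 'a \<Rightarrow> real\<close> and a filtration is a function
  \<open>F :: real \<Rightarrow> 'a measure\<close>; only times in \<open>{0..T}\<close> matter. Only the \<open>\<sigma>\<close>-algebra of \<open>F t\<close> is
  used, never its measure.
\<close>

locale usual_filtered_prob_space = prob_space M
  for M :: "'a measure" and F :: "real \<Rightarrow> 'a measure" and T :: real +
  assumes horizon_pos: "0 < T"
    and filtration_sub: "t \<in> {0..T} \<Longrightarrow> subalgebra M (F t)"
    and filtration_mono: "0 \<le> s \<Longrightarrow> s \<le> t \<Longrightarrow> t \<le> T \<Longrightarrow> sets (F s) \<subseteq> sets (F t)"
    and filtration_right_continuous:
      "0 \<le> t \<Longrightarrow> t < T \<Longrightarrow> sets (F t) = (\<Inter>s\<in>{t<..T}. sets (F s))"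
    and filtration_complete: "N \<in> null_sets M \<Longrightarrow> B \<subseteq> N \<Longrightarrow> B \<in> sets (F 0)"

definition adapted :: "(real \<Rightarrow> 'a measure) \<Rightarrow> real \<Rightarrow> (real \<Rightarrow> 'a \<Rightarrow> real) \<Rightarrow> bool" where
  "adapted F T X \<longleftrightarrow> (\<forall>t\<in>{0..T}. X t \<in> borel_measurable (F t))"

definition jointly_measurable :: "'a measure \<Rightarrow> real \<Rightarrow> (real \<Rightarrow> 'a \<Rightarrow> real) \<Rightarrow> bool" where
  "jointly_measurable M T X \<longleftrightarrow>
     (\<lambda>(t, \<omega>). X t \<omega>) \<in> borel_measurable (restrict_space borel {0..T} \<Otimes>\<^sub>M M)"

definition brownian_motion ::
  "'a measure \<Rightarrow> (real \<Rightarrow> 'a measure) \<Rightarrow> real \<Rightarrow> (real \<Rightarrow> 'a \<Rightarrow> real) \<Rightarrow> bool" where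
  "brownian_motion M F T W \<longleftrightarrow>
     adapted F T W \<and>
     (AE \<omega> in M. W 0 \<omega> = 0) \<and>
     (AE \<omega> in M. continuous_on {0..T} (\<lambda>t. W t \<omega>)) \<and>
     (\<forall>s t. 0 \<le> s \<and> s < t \<and> t \<le> T \<longrightarrow>
        distributed M lborel (\<lambda>\<omega>. W t \<omega> - W s \<omega>) (\<lambda>x. ennreal (normal_density 0 (sqrt (t - s)) x)) \<and>
        prob_space.indep_set M (sets (F s))
          (sets (vimage_algebra (space M) (\<lambda>\<omega>. W t \<omega> - W s \<omega>) borel)))"

definition sup_norm :: "real \<Rightarrow> (real \<Rightarrow> 'a \<Rightarrow> real) \<Rightarrow> 'a \<Rightarrow> ennreal" where
  "sup_norm T X \<omega> = (SUP t\<in>{0..T}. ennreal \<bar>X t \<omega>\<bar>)"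

text \<open>
  The supremum over \<open>{0..T}\<close> of an adapted process need not be a measurable function, hence the
  outer measure. It agrees with \<open>emeasure M\<close> whenever the event is measurable, in which case this
  is convergence in probability as usual.
\<close>

definition tends_to_0_in_prob :: "'a measure \<Rightarrow> (nat \<Rightarrow> 'a \<Rightarrow> ennreal) \<Rightarrow> bool" where
  "tends_to_0_in_prob M X \<longleftrightarrow>
     (\<forall>\<epsilon>::real. \<epsilon> > 0 \<longrightarrow>
        (\<lambda>n. outer_measure_of M {\<omega> \<in> space M. ennreal \<epsilon> < X n \<omega>}) \<longlonglongrightarrow> 0)"

text \<open>
  The data \<open>m, \<tau>, \<xi>\<close> encode the elementary process
  \<open>\<Sum>i<m. \<xi> i * indicator {\<tau> i<..\<tau> (Suc i)}\<close>.
\<close>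

definition elementary ::
  "(real \<Rightarrow> 'a measure) \<Rightarrow> real \<Rightarrow> nat \<Rightarrow> (nat \<Rightarrow> real) \<Rightarrow> (nat \<Rightarrow> 'a \<Rightarrow> real) \<Rightarrow> bool" where
  "elementary F T m \<tau> \<xi> \<longleftrightarrow>
     0 \<le> \<tau> 0 \<and> \<tau> m \<le> T \<and> (\<forall>i<m. \<tau> i \<le> \<tau> (Suc i)) \<and>
     (\<forall>i<m. \<xi> i \<in> borel_measurable (F (\<tau> i)) \<and>
            (\<exists>C. \<forall>\<omega>\<in>space (F (\<tau> i)). \<bar>\<xi> i \<omega>\<bar> \<le> C))"

definition elementary_process ::
  "nat \<Rightarrow> (nat \<Rightarrow> real) \<Rightarrow> (nat \<Rightarrow> 'a \<Rightarrow> real) \<Rightarrow> real \<Rightarrow> 'a \<Rightarrow> real" where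
  "elementary_process m \<tau> \<xi> t \<omega> = (\<Sum>i<m. \<xi> i \<omega> * indicator {\<tau> i<..\<tau> (Suc i)} t)"

definition elementary_integral ::
  "(real \<Rightarrow> 'a \<Rightarrow> real) \<Rightarrow> nat \<Rightarrow> (nat \<Rightarrow> real) \<Rightarrow> (nat \<Rightarrow> 'a \<Rightarrow> real) \<Rightarrow> real \<Rightarrow> 'a \<Rightarrow> real" where
  "elementary_integral W m \<tau> \<xi> t \<omega> =
     (\<Sum>i<m. \<xi> i \<omega> * (W (min t (\<tau> (Suc i))) \<omega> - W (min t (\<tau> i)) \<omega>))"

text \<open>
  \<open>ito_integral M F T W H I\<close>: the process \<open>I\<close> is (a version of) the Ito integral
  \<open>t \<mapsto> \<integral>\<^sub>0\<^sup>t H dW\<close>, in the usual generality of measurable adapted integrands with almost surely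
  square integrable paths. It is the limit, uniformly on \<open>{0..T}\<close> in probability, of the
  integrals of elementary processes that approximate \<open>H\<close> in \<open>L\<^sup>2(0,T)\<close> in probability; such
  approximations exist for every such \<open>H\<close>, and \<open>I\<close> is unique up to indistinguishability.
  It is a relation because processes are only determined up to indistinguishability.
\<close>

definition ito_integral ::
  "'a measure \<Rightarrow> (real \<Rightarrow> 'a measure) \<Rightarrow> real \<Rightarrow> (real \<Rightarrow> 'a \<Rightarrow> real) \<Rightarrow>
   (real \<Rightarrow> 'a \<Rightarrow> real) \<Rightarrow> (real \<Rightarrow> 'a \<Rightarrow> real) \<Rightarrow> bool" where
  "ito_integral M F T W H I \<longleftrightarrow>
     jointly_measurable M T H \<and> adapted F T H \<and>
     (AE \<omega> in M. (\<integral>\<^sup>+ s\<in>{0..T}. ennreal ((H s \<omega>)\<^sup>2) \<partial>lborel) < \<infinity>) \<and>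
     adapted F T I \<and> (AE \<omega> in M. continuous_on {0..T} (\<lambda>t. I t \<omega>)) \<and>
     (\<exists>m \<tau> \<xi>.
        (\<forall>k. elementary F T (m k) (\<tau> k) (\<xi> k)) \<and>
        tends_to_0_in_prob M
          (\<lambda>k \<omega>. \<integral>\<^sup>+ s\<in>{0..T}.
             ennreal ((elementary_process (m k) (\<tau> k) (\<xi> k) s \<omega> - H s \<omega>)\<^sup>2) \<partial>lborel) \<and>
        tends_to_0_in_prob M
          (\<lambda>k. sup_norm T (\<lambda>t \<omega>. elementary_integral W (m k) (\<tau> k) (\<xi> k) t \<omega> - I t \<omega>)))"

text \<open>
  \<open>U(t) = A(t) + \<integral>\<^sub>0\<^sup>t f(U(s)) ds + \<integral>\<^sub>0\<^sup>t g(U(s)) dW(s)\<close> for all \<open>t \<in> {0..T}\<close>, almost surely.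
  The integrability conditions, without which the right-hand side is meaningless, are part of
  being a solution.
\<close>

definition solves_sde ::
  "'a measure \<Rightarrow> (real \<Rightarrow> 'a measure) \<Rightarrow> real \<Rightarrow> (real \<Rightarrow> 'a \<Rightarrow> real) \<Rightarrow>
   (real \<Rightarrow> real) \<Rightarrow> (real \<Rightarrow> real) \<Rightarrow> (real \<Rightarrow> 'a \<Rightarrow> real) \<Rightarrow> (real \<Rightarrow> 'a \<Rightarrow> real) \<Rightarrow> bool" where
  "solves_sde M F T W f g A U \<longleftrightarrow>
     jointly_measurable M T U \<and> adapted F T U \<and>
     (AE \<omega> in M. set_integrable lborel {0..T} (\<lambda>s. f (U s \<omega>))) \<and>
     (\<exists>I. ito_integral M F T W (\<lambda>s \<omega>. g (U s \<omega>)) I \<and>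
        (AE \<omega> in M. \<forall>t\<in>{0..T}.
           U t \<omega> = A t \<omega> + (LINT s:{0..t}|lborel. f (U s \<omega>)) + I t \<omega>))"

end

theory Submission
  imports Defs
begin

text \<open>
  The process \<open>V = U - A\<close> is adapted and almost surely continuous, and
  \<open>dV = f(U) dt + g(U) dW\<close>. Where \<open>\<bar>A\<bar> \<le> \<delta>\<close>, the drift and the martingale part of
  \<open>ln (V\<^sup>2 + \<delta>)\<close>, stopped when \<open>\<bar>V\<bar>\<close> reaches \<open>\<epsilon>\<close>, are controlled by constants that do not
  depend on \<open>\<delta>\<close>: one-sided monotonicity gives \<open>V f(U) \<le> const (V\<^sup>2 + \<delta>)\<close>, and the integrand
  \<open>2 V g(U) / (V\<^sup>2 + \<delta>)\<close> is bounded. Hence, outside an event of small probability,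
  \<open>V\<^sup>2 \<le> 2 \<delta> e\<^sup>c\<close> with \<open>c\<close> independent of \<open>\<delta>\<close>, and \<open>\<delta>\<close> is chosen last.

  Ito's formula is not needed: on a time grid, concavity in the form \<open>ln x - ln y \<le> (x - y) / y\<close>
  bounds the increments of \<open>ln (V\<^sup>2 + \<delta>)\<close>, and of the sum of the squared increments of the
  stochastic integral one only needs that it is bounded in probability. Both that and the
  martingale term follow from the \<open>L\<^sup>2\<close> isometry for elementary integrands, stopped before their
  quadratic variation becomes large.
\<close>

section \<open>Outer measure and Brownian increments\<close>

text \<open>The noise term is multiplicative, as \<open>g\<close> is Lipschitz with
  \<open>g 0 = 0\<close>; under the logarithm it becomes additive with a bounded integrand, which is
  how the constants get rid of \<delta>. The regularising summand must be of first order in \<delta>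
  because of the drift: in \<open>V * f U = U * f U - A * f U\<close> the first product is at most
  \<open>L * U^2\<close>, but \<open>f\<close> may jump at 0, so \<open>f U\<close> is merely
  bounded and the second product is of order \<delta>, not \<delta>^2.

  \<open>A\<close> is only adapted, so neither \<open>A\<close> nor \<open>U\<close> need have
  regular paths; only \<open>V\<close> can be compared between grid points. Stopping is discrete:
  the weights vanish from the first grid time at which |V| \<ge> \<epsilon>, so each is measurable
  at the left end of its cell. How fine the grid must be depends on \<delta>, and the weights are
  unbounded as \<delta> tends to 0. The tail bounds for the stochastic sums may therefore involve
  neither the number of cells nor the size of the weights, only a bound for weight times
  integrand.\<close>

lemma outer_measure_of_union_le:
  assumes "A \<subseteq> B \<union> C" "B \<subseteq> space M" "C \<subseteq> space M"
  shows "outer_measure_of M A \<le> outer_measure_of M B + outer_measure_of M C"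
proof -
  \<comment> \<open>Measurable hulls of equal measure reduce the claim to subadditivity of
    \<open>emeasure\<close>; the sets themselves, events about uncountable suprema, need not be
    measurable.\<close>
  obtain B' C' where B': "B' \<in> sets M" "B \<subseteq> B'" "outer_measure_of M B = emeasure M B'"
    and C': "C' \<in> sets M" "C \<subseteq> C'" "outer_measure_of M C = emeasure M C'"
    using outer_measure_of_attain[OF assms(2)] outer_measure_of_attain[OF assms(3)] by blast
  have "outer_measure_of M A \<le> outer_measure_of M (B' \<union> C')"
    using assms(1) B'(2) C'(2) by (intro outer_measure_of_mono) blast
  also have "\<dots> = emeasure M (B' \<union> C')"
    using B' C' by simp
  also have "\<dots> \<le> emeasure M B' + emeasure M C'"
    using B' C' by (intro emeasure_subadditive) auto
  finally show ?thesis using B' C' by simp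
qed

text \<open>The equation and the continuity of the paths hold only almost surely; enlarging the
  target by a null set costs nothing.\<close>

lemma outer_measure_of_mono_AE:
  assumes "AE x in M. x \<in> A \<longrightarrow> x \<in> B" "A \<subseteq> space M" "B \<subseteq> space M"
  shows "outer_measure_of M A \<le> outer_measure_of M B"
proof -
  obtain N where N: "N \<in> null_sets M" "\<And>x. x \<in> space M - N \<Longrightarrow> x \<in> A \<longrightarrow> x \<in> B"
    using AE_E3[OF assms(1)] by metis
  have "outer_measure_of M A \<le> outer_measure_of M B + outer_measure_of M N"
    using N assms sets.sets_into_space[OF null_setsD2[OF N(1)]]
    by (intro outer_measure_of_union_le) auto
  then show ?thesis using N(1) by (simp add: null_setsD1 null_setsD2)
qed

lemma tendsto_ennreal_0_iff:
  fixes X :: "'b \<Rightarrow> ennreal"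
  shows "(X \<longlongrightarrow> 0) G \<longleftrightarrow> (\<forall>e>0. \<forall>\<^sub>F n in G. X n \<le> ennreal e)"
proof
  assume "(X \<longlongrightarrow> 0) G"
  then show "\<forall>e>0. \<forall>\<^sub>F n in G. X n \<le> ennreal e"
    by (auto dest!: order_tendstoD(2)[where a="ennreal _"] elim!: eventually_mono)
next
  assume *: "\<forall>e>0. \<forall>\<^sub>F n in G. X n \<le> ennreal e"
  show "(X \<longlongrightarrow> 0) G"
  proof (rule order_tendstoI)
    fix a :: ennreal assume "0 < a"
    then obtain b where b: "0 < b" "b < a" using dense by blast
    then have "b \<noteq> top" using top.extremum_strict by auto
    then obtain r where r: "b = ennreal r" "0 \<le> r" by (cases b) auto
    then have "0 < r" using b by (cases "r = 0") auto
    with * r have "\<forall>\<^sub>F n in G. X n \<le> b" by auto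
    then show "\<forall>\<^sub>F n in G. X n < a" by eventually_elim (use b in auto)
  qed auto
qed

lemma tends_to_0_in_probD:
  assumes "tends_to_0_in_prob M X" "0 < \<epsilon>" "0 < \<eta>"
  shows "\<forall>\<^sub>F n in sequentially. outer_measure_of M {\<omega> \<in> space M. ennreal \<epsilon> < X n \<omega>} \<le> ennreal \<eta>"
  using assms by (simp add: tends_to_0_in_prob_def tendsto_ennreal_0_iff)

lemma sup_norm_less_iff:
  "ennreal \<epsilon> < sup_norm T X \<omega> \<longleftrightarrow> (\<exists>t\<in>{0..T}. ennreal \<epsilon> < ennreal \<bar>X t \<omega>\<bar>)"
  by (simp add: sup_norm_def less_SUP_iff)

lemma not_less_sup_normD:
  assumes "\<not> ennreal \<epsilon> < sup_norm T X \<omega>" "t \<in> {0..T}" "0 \<le> \<epsilon>"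
  shows "\<bar>X t \<omega>\<bar> \<le> \<epsilon>"
  using assms by (auto simp: sup_norm_less_iff ennreal_less_iff not_less)

text \<open>Pythagoras in L^2: expanding the square leaves only the diagonal terms.\<close>

lemma (in prob_space) expectation_sum_power2_orthogonal:
  fixes X :: "'b \<Rightarrow> 'a \<Rightarrow> real"
  assumes S: "finite S"
    and int: "\<And>p q. p \<in> S \<Longrightarrow> q \<in> S \<Longrightarrow> integrable M (\<lambda>\<omega>. X p \<omega> * X q \<omega>)"
    and orth: "\<And>p q. p \<in> S \<Longrightarrow> q \<in> S \<Longrightarrow> p \<noteq> q \<Longrightarrow> expectation (\<lambda>\<omega>. X p \<omega> * X q \<omega>) = 0"
  shows "integrable M (\<lambda>\<omega>. (\<Sum>p\<in>S. X p \<omega>)\<^sup>2)"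
    and "expectation (\<lambda>\<omega>. (\<Sum>p\<in>S. X p \<omega>)\<^sup>2) = (\<Sum>p\<in>S. expectation (\<lambda>\<omega>. (X p \<omega>)\<^sup>2))"
proof -
  have eq: "(\<Sum>p\<in>S. X p \<omega>)\<^sup>2 = (\<Sum>p\<in>S. \<Sum>q\<in>S. X p \<omega> * X q \<omega>)" for \<omega>
    by (simp add: power2_eq_square sum_product)
  show "integrable M (\<lambda>\<omega>. (\<Sum>p\<in>S. X p \<omega>)\<^sup>2)"
    unfolding eq using int by (intro Bochner_Integration.integrable_sum) auto
  have "expectation (\<lambda>\<omega>. (\<Sum>p\<in>S. X p \<omega>)\<^sup>2) = (\<Sum>p\<in>S. \<Sum>q\<in>S. expectation (\<lambda>\<omega>. X p \<omega> * X q \<omega>))"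
    unfolding eq using int by (subst Bochner_Integration.integral_sum;
        force intro!: sum.cong Bochner_Integration.integral_sum Bochner_Integration.integrable_sum)
  also have "\<dots> = (\<Sum>p\<in>S. \<Sum>q\<in>S. if p = q then expectation (\<lambda>\<omega>. X p \<omega> * X p \<omega>) else 0)"
    using orth by (intro sum.cong refl) auto
  finally show "expectation (\<lambda>\<omega>. (\<Sum>p\<in>S. X p \<omega>)\<^sup>2) = (\<Sum>p\<in>S. expectation (\<lambda>\<omega>. (X p \<omega>)\<^sup>2))"
    using S by (simp add: sum.delta power2_eq_square)
qed

section \<open>Weighted sums of Brownian increments: isometry and tail bound\<close>

context usual_filtered_prob_space
begin

lemma space_F: "t \<in> {0..T} \<Longrightarrow> space (F t) = space M"
  using filtration_sub by (auto simp: subalgebra_def)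

lemma measurable_F_M: "X \<in> borel_measurable (F t) \<Longrightarrow> t \<in> {0..T} \<Longrightarrow> X \<in> borel_measurable M"
  using filtration_sub measurable_from_subalg by blast

lemma measurable_F_mono:
  "X \<in> borel_measurable (F s) \<Longrightarrow> 0 \<le> s \<Longrightarrow> s \<le> t \<Longrightarrow> t \<le> T \<Longrightarrow> X \<in> borel_measurable (F t)"
  using filtration_mono[of s t] space_F[of s] space_F[of t]
  by (intro measurable_from_subalg[of "F t" "F s"]) (auto simp: subalgebra_def)

text \<open>Collects the Gaussian moments and turns the independence of \<sigma>-algebras in
  \<open>brownian_motion\<close> into independence of random variables, the form in which
  expectations of products factor.\<close>

lemma brownian_increment:
  assumes W: "brownian_motion M F T W" and st: "0 \<le> s" "s < t" "t \<le> T"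
  defines "D \<equiv> \<lambda>\<omega>. W t \<omega> - W s \<omega>"
  shows "D \<in> borel_measurable M" "D \<in> borel_measurable (F t)"
    "integrable M D" "expectation D = 0"
    "integrable M (\<lambda>\<omega>. (D \<omega>)\<^sup>2)" "expectation (\<lambda>\<omega>. (D \<omega>)\<^sup>2) = t - s"
    "\<And>Y :: 'a \<Rightarrow> real. Y \<in> borel_measurable (F s) \<Longrightarrow> indep_var borel Y borel D"
proof -
  have WF: "W t \<in> borel_measurable (F t)" "W s \<in> borel_measurable (F s)"
    using W st by (auto simp: brownian_motion_def adapted_def)
  then have "W s \<in> borel_measurable (F t)" using st by (intro measurable_F_mono[of _ s t]) auto
  then show DF: "D \<in> borel_measurable (F t)" using WF by (simp add: D_def)
  then show DM: "D \<in> borel_measurable M" using st by (intro measurable_F_M[of _ t]) auto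
  have dist: "distributed M lborel D (\<lambda>x. ennreal (normal_density 0 (sqrt (t - s)) x))"
    using W st by (auto simp: brownian_motion_def D_def)
  have \<sigma>: "0 < sqrt (t - s)" using st by simp
  show "integrable M D"
    using integrable_normal_moment_nz_1[OF \<sigma>] by (intro distributed_integrable_var[OF dist]) auto
  show E: "expectation D = 0" by (rule normal_distributed_expectation[OF \<sigma> dist])
  show "integrable M (\<lambda>\<omega>. (D \<omega>)\<^sup>2)"
    using integrable_normal_moment[OF \<sigma>, of 0 2] by (subst distributed_integrable[OF dist, symmetric]) auto
  show "expectation (\<lambda>\<omega>. (D \<omega>)\<^sup>2) = t - s"
    using normal_distributed_variance[OF \<sigma> dist] st by (simp add: E)
  fix Y :: "'a \<Rightarrow> real" assume Y: "Y \<in> borel_measurable (F s)"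
  then have YM: "Y \<in> borel_measurable M" using st by (intro measurable_F_M[of _ s]) auto
  have ind: "indep_set (sets (F s)) (sets (vimage_algebra (space M) D borel))"
    using W st by (auto simp: brownian_motion_def D_def)
  \<comment> \<open>The \<sigma>-algebra generated by \<open>Y\<close> lies inside that of
    \<open>F s\<close>, so it inherits the independence from \<open>D\<close>.\<close>
  have 1: "sigma_sets (space M) {Y -` A \<inter> space M |A. A \<in> sets borel} \<subseteq> sets (F s)"
  proof -
    have "{Y -` A \<inter> space M |A. A \<in> sets borel} \<subseteq> sets (F s)"
      using measurable_sets[OF Y] space_F[of s] st by auto
    then show ?thesis using sets.sigma_sets_subset[of _ "F s"] space_F[of s] st by auto
  qed
  have 2: "sigma_sets (space M) {D -` A \<inter> space M |A. A \<in> sets borel}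
      = sets (vimage_algebra (space M) D borel)"
    by (simp add: vimage_algebra_def sets_measure_of_conv)
      (auto simp: image_def)
  have "indep_set (sigma_sets (space M) {Y -` A \<inter> space M |A. A \<in> sets borel})
     (sets (vimage_algebra (space M) D borel))"
    unfolding indep_set_def
    by (rule indep_sets_mono_sets[OF ind[unfolded indep_set_def]]) (use 1 in \<open>auto split: bool.split\<close>)
  then show "indep_var borel Y borel D"
    unfolding indep_var_eq 2 using YM DM by auto
qed

text \<open>Independence factors the expectations. The first claim kills the mixed terms of a
  squared sum, the other two compute the diagonal ones.\<close>

lemma brownian_increment_product:
  fixes Y :: "'a \<Rightarrow> real"
  assumes W: "brownian_motion M F T W" and st: "0 \<le> s" "s < t" "t \<le> T"
    and Y: "Y \<in> borel_measurable (F s)" "integrable M Y"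
  shows "expectation (\<lambda>\<omega>. Y \<omega> * (W t \<omega> - W s \<omega>)) = 0"
    and "integrable M (\<lambda>\<omega>. Y \<omega> * (W t \<omega> - W s \<omega>)\<^sup>2)"
    and "expectation (\<lambda>\<omega>. Y \<omega> * (W t \<omega> - W s \<omega>)\<^sup>2) = expectation Y * (t - s)"
proof -
  note inc = brownian_increment[OF W st]
  have ind: "indep_var borel Y borel (\<lambda>\<omega>. W t \<omega> - W s \<omega>)" by (rule inc(7)[OF Y(1)])
  show "expectation (\<lambda>\<omega>. Y \<omega> * (W t \<omega> - W s \<omega>)) = 0"
    by (subst indep_var_lebesgue_integral[OF ind Y(2) inc(3)]) (simp only: inc(4) mult_zero_right)
  have "indep_var borel ((\<lambda>x. x) \<circ> Y) borel ((\<lambda>x. x\<^sup>2) \<circ> (\<lambda>\<omega>. W t \<omega> - W s \<omega>))"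
    by (rule indep_var_compose[OF ind]) auto
  then have ind2: "indep_var borel Y borel (\<lambda>\<omega>. (W t \<omega> - W s \<omega>)\<^sup>2)" by (simp add: comp_def)
  show "integrable M (\<lambda>\<omega>. Y \<omega> * (W t \<omega> - W s \<omega>)\<^sup>2)"
    by (rule indep_var_integrable[OF ind2 Y(2) inc(5)])
  show "expectation (\<lambda>\<omega>. Y \<omega> * (W t \<omega> - W s \<omega>)\<^sup>2) = expectation Y * (t - s)"
    by (subst indep_var_lebesgue_integral[OF ind2 Y(2) inc(5)]) (simp only: inc(6))
qed

text \<open>The L^2 isometry: for non-overlapping intervals, the later increment in a mixed product
  is independent of all other factors and has mean zero. The index type is left open because the
  sums will run over pairs of indices from two grids.\<close>

lemma expectation_brownian_sum_power2:
  fixes \<zeta> :: "'b \<Rightarrow> 'a \<Rightarrow> real"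
  assumes W: "brownian_motion M F T W" and P: "finite P"
    and ab: "\<And>p. p \<in> P \<Longrightarrow> 0 \<le> a p" "\<And>p. p \<in> P \<Longrightarrow> a p < b p" "\<And>p. p \<in> P \<Longrightarrow> b p \<le> T"
    and disj: "\<And>p q. p \<in> P \<Longrightarrow> q \<in> P \<Longrightarrow> p \<noteq> q \<Longrightarrow> b p \<le> a q \<or> b q \<le> a p"
    and \<zeta>: "\<And>p. p \<in> P \<Longrightarrow> \<zeta> p \<in> borel_measurable (F (a p))"
    and bd: "\<And>p \<omega>. p \<in> P \<Longrightarrow> \<omega> \<in> space M \<Longrightarrow> \<bar>\<zeta> p \<omega>\<bar> \<le> B"
  shows "integrable M (\<lambda>\<omega>. (\<Sum>p\<in>P. \<zeta> p \<omega> * (W (b p) \<omega> - W (a p) \<omega>))\<^sup>2)"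
    and "expectation (\<lambda>\<omega>. (\<Sum>p\<in>P. \<zeta> p \<omega> * (W (b p) \<omega> - W (a p) \<omega>))\<^sup>2)
      = (\<Sum>p\<in>P. expectation (\<lambda>\<omega>. (\<zeta> p \<omega>)\<^sup>2 * (b p - a p)))"
proof -
  define D where "D p \<omega> = W (b p) \<omega> - W (a p) \<omega>" for p \<omega>
  note inc = brownian_increment[OF W ab, folded D_def]
  have \<zeta>M: "\<zeta> p \<in> borel_measurable M" if "p \<in> P" for p
    using that ab[of p] by (intro measurable_F_M[OF \<zeta>]) auto
  have int\<zeta>2: "integrable M (\<lambda>\<omega>. (\<zeta> p \<omega>)\<^sup>2)" if "p \<in> P" for p
  proof (rule integrable_const_bound[where B="B\<^sup>2"])
    show "AE \<omega> in M. norm ((\<zeta> p \<omega>)\<^sup>2) \<le> B\<^sup>2"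
    proof (rule AE_I2)
      fix \<omega> assume "\<omega> \<in> space M"
      from power_mono[OF bd[OF that this] abs_ge_zero, of 2]
      show "norm ((\<zeta> p \<omega>)\<^sup>2) \<le> B\<^sup>2" by simp
    qed
    show "(\<lambda>\<omega>. (\<zeta> p \<omega>)\<^sup>2) \<in> borel_measurable M" by (intro borel_measurable_power \<zeta>M that)
  qed
  have sq: "integrable M (\<lambda>\<omega>. (\<zeta> p \<omega> * D p \<omega>)\<^sup>2)"
    "expectation (\<lambda>\<omega>. (\<zeta> p \<omega> * D p \<omega>)\<^sup>2) = expectation (\<lambda>\<omega>. (\<zeta> p \<omega>)\<^sup>2 * (b p - a p))" if "p \<in> P" for p
  proof -
    have "(\<lambda>\<omega>. (\<zeta> p \<omega>)\<^sup>2) \<in> borel_measurable (F (a p))" by (intro borel_measurable_power \<zeta> that)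
    from brownian_increment_product(2,3)[OF W ab(1)[OF that] ab(2)[OF that] ab(3)[OF that] this int\<zeta>2[OF that], folded D_def]
    show "integrable M (\<lambda>\<omega>. (\<zeta> p \<omega> * D p \<omega>)\<^sup>2)"
      "expectation (\<lambda>\<omega>. (\<zeta> p \<omega> * D p \<omega>)\<^sup>2) = expectation (\<lambda>\<omega>. (\<zeta> p \<omega>)\<^sup>2 * (b p - a p))"
      using int\<zeta>2[OF that] by (simp_all add: power_mult_distrib)
  qed
  \<comment> \<open>Mixed products are dominated by the sum of the two squares, which are integrable
    by the diagonal case.\<close>
  have prod: "integrable M (\<lambda>\<omega>. (\<zeta> p \<omega> * D p \<omega>) * (\<zeta> q \<omega> * D q \<omega>))" if "p \<in> P" "q \<in> P" for p q
  proof (rule Bochner_Integration.integrable_bound)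
    show "integrable M (\<lambda>\<omega>. (\<zeta> p \<omega> * D p \<omega>)\<^sup>2 + (\<zeta> q \<omega> * D q \<omega>)\<^sup>2)" using sq that by auto
    show "(\<lambda>\<omega>. (\<zeta> p \<omega> * D p \<omega>) * (\<zeta> q \<omega> * D q \<omega>)) \<in> borel_measurable M"
      by (intro borel_measurable_times \<zeta>M that inc(1))
    have "\<bar>x * y\<bar> \<le> x\<^sup>2 + y\<^sup>2" for x y :: real
    proof -
      have "2 * \<bar>x\<bar> * \<bar>y\<bar> \<le> x\<^sup>2 + y\<^sup>2" using sum_squares_bound[of "\<bar>x\<bar>" "\<bar>y\<bar>"] by simp
      moreover have "0 \<le> \<bar>x\<bar> * \<bar>y\<bar>" by simp
      ultimately show ?thesis unfolding abs_mult by linarith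
    qed
    from this[of "\<zeta> p _ * D p _" "\<zeta> q _ * D q _"]
    show "AE \<omega> in M. norm ((\<zeta> p \<omega> * D p \<omega>) * (\<zeta> q \<omega> * D q \<omega>))
        \<le> norm ((\<zeta> p \<omega> * D p \<omega>)\<^sup>2 + (\<zeta> q \<omega> * D q \<omega>)\<^sup>2)"
      unfolding real_norm_def by (intro AE_I2 order_trans[OF _ abs_ge_self])
  qed
  have orth1: "expectation (\<lambda>\<omega>. (\<zeta> p \<omega> * D p \<omega>) * (\<zeta> q \<omega> * D q \<omega>)) = 0"
    if pq: "p \<in> P" "q \<in> P" "b q \<le> a p" for p q
  proof -
    \<comment> \<open>All factors except the increment over \<open>p\<close>, which starts only
      after \<open>q\<close> has ended, are known at time \<open>a p\<close>.\<close>
    let ?Y = "\<lambda>\<omega>. \<zeta> p \<omega> * (\<zeta> q \<omega> * D q \<omega>)"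
    have "D q \<in> borel_measurable (F (a p))"
      using pq ab[of q] ab[of p] by (intro measurable_F_mono[OF inc(2)]) auto
    moreover have "\<zeta> q \<in> borel_measurable (F (a p))"
      using pq ab[of q] ab[of p] by (intro measurable_F_mono[OF \<zeta>]) auto
    ultimately have Y: "?Y \<in> borel_measurable (F (a p))"
      using \<zeta>[OF pq(1)] by (intro borel_measurable_times)
    have "integrable M ?Y"
    proof (rule Bochner_Integration.integrable_bound)
      show "integrable M (\<lambda>\<omega>. B * B * D q \<omega>)" using inc(3) pq by auto
      show "?Y \<in> borel_measurable M" using pq ab[of p] by (intro measurable_F_M[OF Y]) auto
      show "AE \<omega> in M. norm (?Y \<omega>) \<le> norm (B * B * D q \<omega>)"
      proof (rule AE_I2)
        fix \<omega> assume \<omega>: "\<omega> \<in> space M"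
        have "\<bar>\<zeta> p \<omega>\<bar> * \<bar>\<zeta> q \<omega>\<bar> * \<bar>D q \<omega>\<bar> \<le> B * B * \<bar>D q \<omega>\<bar>"
          using bd pq \<omega> order_trans[OF abs_ge_zero bd[OF pq(1) \<omega>]] by (intro mult_mono mult_nonneg_nonneg) auto
        then show "norm (?Y \<omega>) \<le> norm (B * B * D q \<omega>)"
          using order_trans[OF abs_ge_zero bd[OF pq(1) \<omega>]] by (simp add: abs_mult mult.assoc)
      qed
    qed
    from brownian_increment_product(1)[OF W ab(1)[OF pq(1)] ab(2)[OF pq(1)] ab(3)[OF pq(1)] Y this, folded D_def]
    show ?thesis by (simp add: ac_simps)
  qed
  have orth: "expectation (\<lambda>\<omega>. (\<zeta> p \<omega> * D p \<omega>) * (\<zeta> q \<omega> * D q \<omega>)) = 0"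
    if pq: "p \<in> P" "q \<in> P" "p \<noteq> q" for p q
    using disj[OF pq] orth1[of p q] orth1[of q p] pq by (auto simp: mult.commute)
  show "integrable M (\<lambda>\<omega>. (\<Sum>p\<in>P. \<zeta> p \<omega> * (W (b p) \<omega> - W (a p) \<omega>))\<^sup>2)"
    using expectation_sum_power2_orthogonal(1)[OF P prod orth] by (simp add: D_def)
  show "expectation (\<lambda>\<omega>. (\<Sum>p\<in>P. \<zeta> p \<omega> * (W (b p) \<omega> - W (a p) \<omega>))\<^sup>2)
      = (\<Sum>p\<in>P. expectation (\<lambda>\<omega>. (\<zeta> p \<omega>)\<^sup>2 * (b p - a p)))"
    using expectation_sum_power2_orthogonal(2)[OF P prod orth] sq(2) by (simp add: D_def)
qed

text \<open>Markov's inequality for the stopped sums; on the event in question nothing is stopped.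
  The first component of an index is a cell of a coarser grid: by the isometry, the square of the
  total and the sum of the squares over the cells have the same expectation, hence the factor 2. The
  bound \<open>B\<close> serves integrability.\<close>

lemma brownian_sum_tail:
  fixes \<zeta> :: "nat \<times> nat \<Rightarrow> 'a \<Rightarrow> real"
  assumes W: "brownian_motion M F T W" and P: "finite P" "\<And>p. p \<in> P \<Longrightarrow> fst p < J"
    and ab: "\<And>p. p \<in> P \<Longrightarrow> 0 \<le> a p" "\<And>p. p \<in> P \<Longrightarrow> a p < b p" "\<And>p. p \<in> P \<Longrightarrow> b p \<le> T"
    and disj: "\<And>p q. p \<in> P \<Longrightarrow> q \<in> P \<Longrightarrow> p \<noteq> q \<Longrightarrow> b p \<le> a q \<or> b q \<le> a p"
    and \<zeta>: "\<And>p. p \<in> P \<Longrightarrow> \<zeta> p \<in> borel_measurable (F (a p))"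
    and bd: "\<And>p \<omega>. p \<in> P \<Longrightarrow> \<omega> \<in> space M \<Longrightarrow> \<bar>\<zeta> p \<omega>\<bar> \<le> B"
    and K: "0 < K" and r: "0 \<le> r"
  shows "outer_measure_of M {\<omega> \<in> space M.
      K < (\<Sum>p\<in>P. \<zeta> p \<omega> * (W (b p) \<omega> - W (a p) \<omega>))\<^sup>2
        + (\<Sum>i<J. (\<Sum>p\<in>{p\<in>P. fst p = i}. \<zeta> p \<omega> * (W (b p) \<omega> - W (a p) \<omega>))\<^sup>2)
      \<and> (\<Sum>p\<in>P. (\<zeta> p \<omega>)\<^sup>2 * (b p - a p)) \<le> r} \<le> ennreal (2 * r / K)"
proof -
  define G where "G p \<omega> = (\<Sum>q\<in>{q\<in>P. b q \<le> b p}. (\<zeta> q \<omega>)\<^sup>2 * (b q - a q))" for p \<omega>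
  \<comment> \<open>\<open>G p\<close> is known at time \<open>a p\<close>, so \<open>\<zeta>\<close> can be stopped before its quadratic variation exceeds \<open>r\<close>.\<close>
  define \<zeta>' where "\<zeta>' p \<omega> = (if G p \<omega> \<le> r then \<zeta> p \<omega> else 0)" for p \<omega>
  define X where "X p \<omega> = \<zeta>' p \<omega> * (W (b p) \<omega> - W (a p) \<omega>)" for p \<omega>
  define Z where "Z \<omega> = (\<Sum>p\<in>P. X p \<omega>)\<^sup>2 + (\<Sum>i<J. (\<Sum>p\<in>{p\<in>P. fst p = i}. X p \<omega>)\<^sup>2)" for \<omega>
  have Gmeas: "G p \<in> borel_measurable (F (a p))" if p: "p \<in> P" for p
  proof -
    have "\<zeta> q \<in> borel_measurable (F (a p))" if q: "q \<in> P" "b q \<le> b p" for q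
    proof -
      \<comment> \<open>Disjointness forces an interval that ends no later than \<open>p\<close> to
        start no later as well, so its weight is known at \<open>a p\<close>.\<close>
      have "a q \<le> a p" using disj[OF p q(1)] ab(2)[OF q(1)] q(2) by (cases "p = q") auto
      then show ?thesis
        using ab(1)[OF q(1)] ab(2)[OF p] ab(3)[OF p] by (intro measurable_F_mono[OF \<zeta>[OF q(1)]]) auto
    qed
    then show ?thesis unfolding G_def
      by (intro borel_measurable_sum borel_measurable_times borel_measurable_power borel_measurable_const) auto
  qed
  have \<zeta>': "\<zeta>' p \<in> borel_measurable (F (a p))" if "p \<in> P" for p
    unfolding \<zeta>'_def using Gmeas[OF that] \<zeta>[OF that]
    by (intro measurable_If borel_measurable_const) auto
  have bd': "\<bar>\<zeta>' p \<omega>\<bar> \<le> B" if "p \<in> P" "\<omega> \<in> space M" for p \<omega>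
    using bd[OF that] by (auto simp: \<zeta>'_def)
  have nonneg: "0 \<le> (\<zeta> p \<omega>)\<^sup>2 * (b p - a p)" if "p \<in> P" for p \<omega>
    using ab(2)[OF that] by simp
  \<comment> \<open>Among the surviving indices, the one with the latest end has all the others in
    its \<open>G\<close>, and this \<open>G\<close> is at most \<open>r\<close>.\<close>
  have total: "(\<Sum>p\<in>P. (\<zeta>' p \<omega>)\<^sup>2 * (b p - a p)) \<le> r" for \<omega>
  proof -
    let ?P = "{p\<in>P. G p \<omega> \<le> r}"
    have eq: "(\<Sum>p\<in>P. (\<zeta>' p \<omega>)\<^sup>2 * (b p - a p)) = (\<Sum>p\<in>?P. (\<zeta> p \<omega>)\<^sup>2 * (b p - a p))"
      using P(1) by (intro sum.mono_neutral_cong_right) (auto simp: \<zeta>'_def)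
    show ?thesis
    proof (cases "?P = {}")
      case True
      show ?thesis unfolding eq True using r by simp
    next
      case False
      then have "Max (b ` ?P) \<in> b ` ?P" using P(1) by (intro Max_in) auto
      then obtain p where p: "p \<in> ?P" "b p = Max (b ` ?P)" by auto
      have "b q \<le> b p" if "q \<in> ?P" for q unfolding p(2) using that P(1) by (intro Max_ge) auto
      then have "(\<Sum>p\<in>?P. (\<zeta> p \<omega>)\<^sup>2 * (b p - a p)) \<le> G p \<omega>"
        unfolding G_def using P(1) nonneg by (intro sum_mono2) auto
      then show ?thesis using p(1) eq by auto
    qed
  qed
  have sub: "integrable M (\<lambda>\<omega>. (\<Sum>p\<in>S. X p \<omega>)\<^sup>2)"
    "expectation (\<lambda>\<omega>. (\<Sum>p\<in>S. X p \<omega>)\<^sup>2) = (\<Sum>p\<in>S. expectation (\<lambda>\<omega>. (\<zeta>' p \<omega>)\<^sup>2 * (b p - a p)))"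
    if "S \<subseteq> P" for S
  proof -
    note * = expectation_brownian_sum_power2[OF W finite_subset[OF that P(1)], of a b \<zeta>' B, folded X_def]
    show "integrable M (\<lambda>\<omega>. (\<Sum>p\<in>S. X p \<omega>)\<^sup>2)"
      by (rule *(1)) (rule ab disj \<zeta>' bd'; (erule subsetD[OF that] | assumption))+
    show "expectation (\<lambda>\<omega>. (\<Sum>p\<in>S. X p \<omega>)\<^sup>2) = (\<Sum>p\<in>S. expectation (\<lambda>\<omega>. (\<zeta>' p \<omega>)\<^sup>2 * (b p - a p)))"
      by (rule *(2)) (rule ab disj \<zeta>' bd'; (erule subsetD[OF that] | assumption))+
  qed
  have intZ: "integrable M Z"
    unfolding Z_def by (intro Bochner_Integration.integrable_add Bochner_Integration.integrable_sum sub) auto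
  have "expectation Z = (\<Sum>p\<in>P. expectation (\<lambda>\<omega>. (\<zeta>' p \<omega>)\<^sup>2 * (b p - a p)))
      + (\<Sum>i<J. \<Sum>p\<in>{p\<in>P. fst p = i}. expectation (\<lambda>\<omega>. (\<zeta>' p \<omega>)\<^sup>2 * (b p - a p)))"
    unfolding Z_def
    by (subst Bochner_Integration.integral_add, (intro Bochner_Integration.integrable_sum sub; auto)+,
        subst Bochner_Integration.integral_sum, (intro sub; auto), simp add: sub)
  \<comment> \<open>The cells partition \<open>P\<close>, so the second term repeats the
    first.\<close>
  also have "\<dots> = 2 * (\<Sum>p\<in>P. expectation (\<lambda>\<omega>. (\<zeta>' p \<omega>)\<^sup>2 * (b p - a p)))"
    using P by (subst sum.group) auto
  also have "(\<Sum>p\<in>P. expectation (\<lambda>\<omega>. (\<zeta>' p \<omega>)\<^sup>2 * (b p - a p)))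
      = expectation (\<lambda>\<omega>. \<Sum>p\<in>P. (\<zeta>' p \<omega>)\<^sup>2 * (b p - a p))"
  proof (rule Bochner_Integration.integral_sum[symmetric])
    fix p assume p: "p \<in> P"
    show "integrable M (\<lambda>\<omega>. (\<zeta>' p \<omega>)\<^sup>2 * (b p - a p))"
    proof (rule integrable_const_bound[where B="B\<^sup>2 * (b p - a p)"])
      show "AE \<omega> in M. norm ((\<zeta>' p \<omega>)\<^sup>2 * (b p - a p)) \<le> B\<^sup>2 * (b p - a p)"
      proof (rule AE_I2)
        fix \<omega> assume "\<omega> \<in> space M"
        from power_mono[OF bd'[OF p this] abs_ge_zero, of 2] ab(2)[OF p]
        show "norm ((\<zeta>' p \<omega>)\<^sup>2 * (b p - a p)) \<le> B\<^sup>2 * (b p - a p)"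
          by (simp add: abs_mult)
      qed
      show "(\<lambda>\<omega>. (\<zeta>' p \<omega>)\<^sup>2 * (b p - a p)) \<in> borel_measurable M"
        using p ab(1)[OF p] ab(2)[OF p] ab(3)[OF p]
        by (intro borel_measurable_times borel_measurable_power borel_measurable_const
            measurable_F_M[OF \<zeta>']) auto
    qed
  qed
  also have "expectation (\<lambda>\<omega>. \<Sum>p\<in>P. (\<zeta>' p \<omega>)\<^sup>2 * (b p - a p)) \<le> r"
  proof -
    have "expectation (\<lambda>\<omega>. \<Sum>p\<in>P. (\<zeta>' p \<omega>)\<^sup>2 * (b p - a p)) \<le> expectation (\<lambda>\<omega>. r)"
      using total r by (intro integral_mono') auto
    then show ?thesis by (simp add: prob_space)
  qed
  finally have EZ: "expectation Z \<le> 2 * r" by simp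
  have "outer_measure_of M {\<omega> \<in> space M.
      K < (\<Sum>p\<in>P. \<zeta> p \<omega> * (W (b p) \<omega> - W (a p) \<omega>))\<^sup>2
        + (\<Sum>i<J. (\<Sum>p\<in>{p\<in>P. fst p = i}. \<zeta> p \<omega> * (W (b p) \<omega> - W (a p) \<omega>))\<^sup>2)
      \<and> (\<Sum>p\<in>P. (\<zeta> p \<omega>)\<^sup>2 * (b p - a p)) \<le> r} \<le> outer_measure_of M {\<omega> \<in> space M. K \<le> Z \<omega>}"
  proof (intro outer_measure_of_mono subsetI, clarsimp)
    fix \<omega>
    assume *: "K < (\<Sum>p\<in>P. \<zeta> p \<omega> * (W (b p) \<omega> - W (a p) \<omega>))\<^sup>2
        + (\<Sum>i<J. (\<Sum>p\<in>{p\<in>P. fst p = i}. \<zeta> p \<omega> * (W (b p) \<omega> - W (a p) \<omega>))\<^sup>2)"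
      and Q: "(\<Sum>p\<in>P. (\<zeta> p \<omega>)\<^sup>2 * (b p - a p)) \<le> r"
    \<comment> \<open>Each \<open>G p\<close> is a partial sum of the full quadratic variation, so
      on this event the stopping never acts.\<close>
    have "G p \<omega> \<le> r" for p
      using Q by (rule order_trans[rotated]) (use P(1) nonneg in \<open>auto simp: G_def intro!: sum_mono2\<close>)
    then have "\<zeta>' p \<omega> = \<zeta> p \<omega>" for p by (simp add: \<zeta>'_def)
    then show "K \<le> Z \<omega>" using * by (simp add: Z_def X_def)
  qed
  also have "\<dots> = emeasure M {\<omega> \<in> space M. K \<le> Z \<omega>}"
    using borel_measurable_integrable[OF intZ] by (intro outer_measure_of_eq) measurable
  also have "\<dots> \<le> ennreal (1 / K * expectation Z)"
  proof (rule integral_Markov_inequality[OF intZ _ K])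
    show "AE \<omega> in M. 0 \<le> Z \<omega>" by (auto simp: Z_def intro!: add_nonneg_nonneg sum_nonneg)
  qed
  also have "\<dots> \<le> ennreal (2 * r / K)"
    using EZ K by (intro ennreal_leI) (simp add: field_simps)
  finally show ?thesis .
qed

end

section \<open>Increments of the Ito integral on a time grid\<close>

lemma mono_on_gridD:
  fixes t :: "nat \<Rightarrow> real"
  assumes "\<And>i. i < J \<Longrightarrow> t i \<le> t (Suc i)" "i \<le> j" "j \<le> J"
  shows "t i \<le> t j"
  using assms(2,3)
proof (induction j rule: dec_induct)
  case (step n)
  then show ?case using assms(1)[of n] by simp
qed simp

lemma sum_grid_indicator:
  fixes t f :: "nat \<Rightarrow> real"
  assumes t: "\<And>i. i < J \<Longrightarrow> t i \<le> t (Suc i)" and i: "i < J" "s \<in> {t i<..t (Suc i)}"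
  shows "(\<Sum>j<J. f j * indicator {t j<..t (Suc j)} s) = f i"
proof -
  have "s \<notin> {t j<..t (Suc j)}" if "j < J" "j \<noteq> i" for j
    using mono_on_gridD[of J t "Suc i" j] mono_on_gridD[of J t "Suc j" i] t that i
    by (cases "j < i") force+
  then have "(\<Sum>j<J. f j * indicator {t j<..t (Suc j)} s) = (\<Sum>j<J. if j = i then f i else 0)"
    using i by (intro sum.cong) auto
  then show ?thesis using i(1) by simp
qed

lemma borel_measurable_elementary_process [measurable]:
  "(\<lambda>s. elementary_process m \<tau> \<xi> s \<omega>) \<in> borel_measurable borel"
  unfolding elementary_process_def by measurable

context usual_filtered_prob_space
begin

text \<open>The common refinement of the grid \<open>t\<close> and the partition
  \<open>\<tau>\<close> turns both sums into sums of Brownian increments with weights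
  \<open>c i * \<xi> l\<close>, grouped by the cell \<open>i\<close> of \<open>t\<close>.\<close>

lemma elementary_integral_grid_tail:
  fixes W :: "real \<Rightarrow> 'a \<Rightarrow> real" and t \<tau> :: "nat \<Rightarrow> real" and c \<xi> :: "nat \<Rightarrow> 'a \<Rightarrow> real"
    and m J :: nat
  defines "Y \<equiv> \<lambda>i \<omega>. c i \<omega> * (elementary_integral W m \<tau> \<xi> (t (Suc i)) \<omega> - elementary_integral W m \<tau> \<xi> (t i) \<omega>)"
  assumes W: "brownian_motion M F T W" and el: "elementary F T m \<tau> \<xi>"
    and t: "0 \<le> t 0" "t J \<le> T" "\<And>i. i < J \<Longrightarrow> t i \<le> t (Suc i)"
    and c: "\<And>i. i < J \<Longrightarrow> c i \<in> borel_measurable (F (t i))"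
    and B: "\<And>i \<omega>. i < J \<Longrightarrow> \<omega> \<in> space M \<Longrightarrow> \<bar>c i \<omega>\<bar> \<le> B"
    and K: "0 < K" and r: "0 \<le> r"
  shows "outer_measure_of M {\<omega> \<in> space M. K < (\<Sum>i<J. Y i \<omega>)\<^sup>2 + (\<Sum>i<J. (Y i \<omega>)\<^sup>2)
    \<and> (\<integral>\<^sup>+ s\<in>{0..T}. ennreal (((\<Sum>i<J. c i \<omega> * indicator {t i<..t (Suc i)} s)
         * elementary_process m \<tau> \<xi> s \<omega>)\<^sup>2) \<partial>lborel) \<le> ennreal r} \<le> ennreal (2 * r / K)"
proof -
  have \<tau>: "0 \<le> \<tau> 0" "\<tau> m \<le> T" "\<And>l. l < m \<Longrightarrow> \<tau> l \<le> \<tau> (Suc l)"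
    and \<xi>: "\<And>l. l < m \<Longrightarrow> \<xi> l \<in> borel_measurable (F (\<tau> l))"
    and "\<forall>l<m. \<exists>C. \<forall>\<omega>\<in>space (F (\<tau> l)). \<bar>\<xi> l \<omega>\<bar> \<le> C"
    using el by (auto simp: elementary_def)
  then obtain C where C: "\<And>l \<omega>. l < m \<Longrightarrow> \<omega> \<in> space (F (\<tau> l)) \<Longrightarrow> \<bar>\<xi> l \<omega>\<bar> \<le> C l" by metis
  note t_mono = mono_on_gridD[of J t, OF t(3)] and \<tau>_mono = mono_on_gridD[of m \<tau>, OF \<tau>(3)]
  have \<tau>_in: "0 \<le> \<tau> l" "\<tau> l \<le> T" if "l \<le> m" for l
    using \<tau>_mono[of 0 l] \<tau>_mono[of l m] \<tau>(1,2) that by auto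
  have t_in: "0 \<le> t i" "t i \<le> T" if "i \<le> J" for i
    using t_mono[of 0 i] t_mono[of i J] t(1,2) that by auto
  \<comment> \<open>Clamping the ends of the \<open>l\<close>-th interval of \<open>\<tau>\<close>
    to the \<open>i\<close>-th cell of \<open>t\<close> gives their intersection. If it is empty,
    both clamped ends coincide and the increment is zero; \<open>P\<close> keeps the nondegenerate
    pairs.\<close>
  define a where "a = (\<lambda>(i, l). max (t i) (min (t (Suc i)) (\<tau> l)))"
  define b where "b = (\<lambda>(i, l). max (t i) (min (t (Suc i)) (\<tau> (Suc l))))"
  define \<zeta> where "\<zeta> = (\<lambda>(i, l) \<omega>. c i \<omega> * \<xi> l \<omega>)"
  define P where "P = {p \<in> {..<J} \<times> {..<m}. a p < b p}"
  define B' where "B' = B * (\<Sum>l<m. \<bar>C l\<bar>)"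
  have P: "finite P" "\<And>p. p \<in> P \<Longrightarrow> fst p < J" by (auto simp: P_def)
  have inP: "a (i, l) \<ge> t i" "a (i, l) \<ge> \<tau> l" "b (i, l) \<le> t (Suc i)" "b (i, l) \<le> \<tau> (Suc l)" "i < J" "l < m"
    if "(i, l) \<in> P" for i l
    using that t(3)[of i] \<tau>(3)[of l] by (auto simp: P_def a_def b_def)
  have ab: "0 \<le> a p" "a p < b p" "b p \<le> T" if "p \<in> P" for p
  proof -
    obtain i l where p: "p = (i, l)" by force
    note * = inP[OF that[unfolded p]]
    show "0 \<le> a p" using *(1) t_in(1)[of i] *(5) by (simp add: p)
    show "b p \<le> T" using *(3) t_in(2)[of "Suc i"] *(5) by (simp add: p)
  qed (use that in \<open>simp add: P_def\<close>)
  have disj: "b p \<le> a q \<or> b q \<le> a p" if "p \<in> P" "q \<in> P" "p \<noteq> q" for p q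
  proof -
    obtain i l i' l' where p: "p = (i, l)" and q: "q = (i', l')" by force
    note * = inP[OF that(1)[unfolded p]] and ** = inP[OF that(2)[unfolded q]]
    have ne: "i \<noteq> i' \<or> l \<noteq> l'" using that(3) by (simp add: p q)
    consider "i < i'" | "i' < i" | "l < l'" | "l' < l" using ne by linarith
    then show ?thesis
    proof cases
      case 1
      then have "t (Suc i) \<le> t i'" using **(5) by (intro t_mono) auto
      then show ?thesis using *(3) **(1) by (simp add: p q)
    next
      case 2
      then have "t (Suc i') \<le> t i" using *(5) by (intro t_mono) auto
      then show ?thesis using **(3) *(1) by (simp add: p q)
    next
      case 3
      then have "\<tau> (Suc l) \<le> \<tau> l'" using **(6) by (intro \<tau>_mono) auto
      then show ?thesis using *(4) **(2) by (simp add: p q)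
    next
      case 4
      then have "\<tau> (Suc l') \<le> \<tau> l" using *(6) by (intro \<tau>_mono) auto
      then show ?thesis using **(4) *(2) by (simp add: p q)
    qed
  qed
  have \<zeta>: "\<zeta> p \<in> borel_measurable (F (a p))" if "p \<in> P" for p
  proof -
    obtain i l where p: "p = (i, l)" by force
    note * = inP[OF that[unfolded p]]
    have "c i \<in> borel_measurable (F (a p))"
      using * t_in[of i] ab[OF that] by (intro measurable_F_mono[OF c]) (auto simp: p)
    moreover have "\<xi> l \<in> borel_measurable (F (a p))"
      using * \<tau>_in[of l] ab[OF that] by (intro measurable_F_mono[OF \<xi>]) (auto simp: p)
    ultimately show ?thesis unfolding \<zeta>_def p prod.case by (rule borel_measurable_times)
  qed
  have bd: "\<bar>\<zeta> p \<omega>\<bar> \<le> B'" if "p \<in> P" "\<omega> \<in> space M" for p \<omega>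
  proof -
    obtain i l where p: "p = (i, l)" by force
    note * = inP[OF that(1)[unfolded p]]
    have "\<bar>\<xi> l \<omega>\<bar> \<le> C l" using C[of l \<omega>] *(6) \<tau>_in[of l] that(2) by (simp add: space_F)
    also have "\<dots> \<le> \<bar>C l\<bar>" by simp
    also have "\<dots> \<le> (\<Sum>l<m. \<bar>C l\<bar>)" using *(6) by (intro member_le_sum) auto
    finally show ?thesis
      using B[OF *(5) that(2)] order_trans[OF abs_ge_zero B[OF *(5) that(2)]]
      by (auto simp: p \<zeta>_def B'_def abs_mult intro!: mult_mono)
  qed
  let ?D = "\<lambda>p \<omega>. W (b p) \<omega> - W (a p) \<omega>"
  \<comment> \<open>The roles of the upper limit and of the partition point can be exchanged: a
    mixed difference of \<open>W\<close> at minima is a single increment between clamped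
    times.\<close>
  have incr: "W (min t' \<tau>'') \<omega> - W (min t' \<tau>') \<omega> - (W (min u \<tau>'') \<omega> - W (min u \<tau>') \<omega>)
      = W (max u (min t' \<tau>'')) \<omega> - W (max u (min t' \<tau>')) \<omega>" if "u \<le> t'" "\<tau>' \<le> \<tau>''" for u t' \<tau>' \<tau>'' \<omega>
    using that by (auto simp: min_def max_def)
  have Yi: "Y i \<omega> = (\<Sum>p\<in>{p\<in>P. fst p = i}. \<zeta> p \<omega> * ?D p \<omega>)" if i: "i < J" for i \<omega>
  proof -
    have "Y i \<omega> = (\<Sum>l<m. c i \<omega> * (\<xi> l \<omega> *
        (W (min (t (Suc i)) (\<tau> (Suc l))) \<omega> - W (min (t (Suc i)) (\<tau> l)) \<omega>
          - (W (min (t i) (\<tau> (Suc l))) \<omega> - W (min (t i) (\<tau> l)) \<omega>))))"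
      unfolding Y_def elementary_integral_def
      by (simp only: sum_subtractf[symmetric] sum_distrib_left right_diff_distrib)
    also have "\<dots> = (\<Sum>l<m. \<zeta> (i, l) \<omega> * ?D (i, l) \<omega>)"
      using t(3)[OF i] \<tau>(3) by (intro sum.cong refl) (simp add: incr a_def b_def \<zeta>_def)
    also have "\<dots> = (\<Sum>p\<in>Pair i ` {..<m}. \<zeta> p \<omega> * ?D p \<omega>)"
      by (subst sum.reindex) (auto simp: inj_on_def)
    also have "\<dots> = (\<Sum>p\<in>{p\<in>P. fst p = i}. \<zeta> p \<omega> * ?D p \<omega>)"
    proof (rule sum.mono_neutral_right)
      show "\<forall>p\<in>Pair i ` {..<m} - {p \<in> P. fst p = i}. \<zeta> p \<omega> * ?D p \<omega> = 0"
      proof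
        fix p assume "p \<in> Pair i ` {..<m} - {p \<in> P. fst p = i}"
        then obtain l where l: "p = (i, l)" "l < m" "(i, l) \<notin> P" by auto
        have "a (i, l) \<le> b (i, l)" using \<tau>(3)[OF l(2)] by (auto simp: a_def b_def)
        then have "a (i, l) = b (i, l)" using l i by (auto simp: P_def)
        then show "\<zeta> p \<omega> * ?D p \<omega> = 0" by (simp add: l)
      qed
    qed (auto simp: P_def)
    finally show ?thesis .
  qed
  have Ysum: "(\<Sum>i<J. Y i \<omega>) = (\<Sum>p\<in>P. \<zeta> p \<omega> * ?D p \<omega>)" for \<omega>
    
  proof -
    have "(\<Sum>i<J. Y i \<omega>) = (\<Sum>i<J. \<Sum>p\<in>{p\<in>P. fst p = i}. \<zeta> p \<omega> * ?D p \<omega>)" by (simp add: Yi)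
    also have "\<dots> = (\<Sum>p\<in>P. \<zeta> p \<omega> * ?D p \<omega>)" using P by (intro sum.group) auto
    finally show ?thesis .
  qed
  \<comment> \<open>The refined cells are disjoint and the weighted elementary process equals
    \<open>\<zeta> p\<close> on the cell \<open>p\<close>, so the discrete quadratic variation is at
    most the integral of its square.\<close>
  have quad: "(\<Sum>p\<in>P. (\<zeta> p \<omega>)\<^sup>2 * (b p - a p)) \<le> r"
    if Q: "(\<integral>\<^sup>+ s\<in>{0..T}. ennreal (((\<Sum>i<J. c i \<omega> * indicator {t i<..t (Suc i)} s)
         * elementary_process m \<tau> \<xi> s \<omega>)\<^sup>2) \<partial>lborel) \<le> ennreal r" for \<omega>
  proof -
    have "ennreal (\<Sum>p\<in>P. (\<zeta> p \<omega>)\<^sup>2 * (b p - a p)) = (\<Sum>p\<in>P. ennreal ((\<zeta> p \<omega>)\<^sup>2 * (b p - a p)))"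
      using ab(2) by (intro sum_ennreal[symmetric]) (simp add: less_imp_le)
    also have "\<dots> = (\<Sum>p\<in>P. \<integral>\<^sup>+ s. ennreal ((\<zeta> p \<omega>)\<^sup>2) * indicator {a p<..b p} s \<partial>lborel)"
      using ab(2) by (intro sum.cong refl)
        (simp add: nn_integral_cmult_indicator ennreal_mult'' less_imp_le)
    also have "\<dots> = (\<integral>\<^sup>+ s. (\<Sum>p\<in>P. ennreal ((\<zeta> p \<omega>)\<^sup>2) * indicator {a p<..b p} s) \<partial>lborel)"
      by (intro nn_integral_sum[symmetric]) auto
    also have "\<dots> \<le> (\<integral>\<^sup>+ s\<in>{0..T}. ennreal (((\<Sum>i<J. c i \<omega> * indicator {t i<..t (Suc i)} s)
         * elementary_process m \<tau> \<xi> s \<omega>)\<^sup>2) \<partial>lborel)"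
    proof (rule nn_integral_mono)
      fix s :: real
      let ?R = "ennreal (((\<Sum>i<J. c i \<omega> * indicator {t i<..t (Suc i)} s)
         * elementary_process m \<tau> \<xi> s \<omega>)\<^sup>2) * indicator {0..T} s"
      show "(\<Sum>p\<in>P. ennreal ((\<zeta> p \<omega>)\<^sup>2) * indicator {a p<..b p} s) \<le> ?R"
      proof (cases "\<exists>p\<in>P. s \<in> {a p<..b p}")
        case True
        then obtain i l where p: "(i, l) \<in> P" "s \<in> {a (i, l)<..b (i, l)}" by auto
        have "s \<notin> {a q<..b q}" if "q \<in> P" "q \<noteq> (i, l)" for q
          using disj[OF that(1) p(1) that(2)] p(2) by auto
        then have "(\<Sum>p\<in>P. ennreal ((\<zeta> p \<omega>)\<^sup>2) * indicator {a p<..b p} s)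
            = (\<Sum>p\<in>P. if p = (i, l) then ennreal ((\<zeta> (i, l) \<omega>)\<^sup>2) else 0)"
          using p by (intro sum.cong) auto
        also have "\<dots> = ennreal ((\<zeta> (i, l) \<omega>)\<^sup>2)" using p(1) P(1) by simp
        also have "\<dots> = ?R"
        proof -
          note * = inP[OF p(1)]
          have "(\<Sum>i<J. c i \<omega> * indicator {t i<..t (Suc i)} s) = c i \<omega>"
            using * p(2) by (intro sum_grid_indicator t(3)) auto
          moreover have "elementary_process m \<tau> \<xi> s \<omega> = \<xi> l \<omega>"
            unfolding elementary_process_def using * p(2) by (intro sum_grid_indicator \<tau>(3)) auto
          moreover have "s \<in> {0..T}" using ab(1,3)[OF p(1)] p(2) by auto
          ultimately show ?thesis by (simp add: \<zeta>_def)
        qed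
        finally show ?thesis by simp
      next
        case False
        then have "(\<Sum>p\<in>P. ennreal ((\<zeta> p \<omega>)\<^sup>2) * indicator {a p<..b p} s) = 0"
          by (intro sum.neutral) auto
        then show ?thesis by simp
      qed
    qed
    also have "\<dots> \<le> ennreal r" by (rule Q)
    finally show ?thesis using r by (simp add: ennreal_le_iff)
  qed
  have "outer_measure_of M {\<omega> \<in> space M. K < (\<Sum>i<J. Y i \<omega>)\<^sup>2 + (\<Sum>i<J. (Y i \<omega>)\<^sup>2)
    \<and> (\<integral>\<^sup>+ s\<in>{0..T}. ennreal (((\<Sum>i<J. c i \<omega> * indicator {t i<..t (Suc i)} s)
         * elementary_process m \<tau> \<xi> s \<omega>)\<^sup>2) \<partial>lborel) \<le> ennreal r}
    \<le> outer_measure_of M {\<omega> \<in> space M.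
      K < (\<Sum>p\<in>P. \<zeta> p \<omega> * ?D p \<omega>)\<^sup>2 + (\<Sum>i<J. (\<Sum>p\<in>{p\<in>P. fst p = i}. \<zeta> p \<omega> * ?D p \<omega>)\<^sup>2)
      \<and> (\<Sum>p\<in>P. (\<zeta> p \<omega>)\<^sup>2 * (b p - a p)) \<le> r}"
    using quad by (intro outer_measure_of_mono) (auto simp: Ysum[symmetric] Yi[symmetric])
  also have "\<dots> \<le> ennreal (2 * r / K)"
    by (rule brownian_sum_tail[OF W P ab disj \<zeta> bd K r])
  finally show ?thesis .
qed

end

text \<open>Joint measurability is given over \<open>{0..T}\<close>; the indicator extends the path
  by zero to a Borel function on the line.\<close>

lemma borel_measurable_section:
  assumes X: "jointly_measurable M T X" and \<omega>: "\<omega> \<in> space M"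
  shows "(\<lambda>s. indicator {0..T} s * X s \<omega>) \<in> borel_measurable borel"
proof -
  have "(\<lambda>s. (\<lambda>(t, \<omega>). X t \<omega>) (s, \<omega>)) \<in> borel_measurable (restrict_space borel {0..T})"
    by (rule measurable_compose[OF measurable_Pair2'[OF \<omega>] X[unfolded jointly_measurable_def]])
  then show ?thesis by (simp add: borel_measurable_restrict_space_iff)
qed

section \<open>Passage from elementary integrals to the Ito integral\<close>

context usual_filtered_prob_space
begin

text \<open>The start value of \<open>I\<close> is not prescribed by \<open>ito_integral\<close>.
  But every elementary integral vanishes at time 0, and uniform approximation then makes a deviation
  above \<epsilon> less likely than any \<eta>.\<close>

lemma ito_integral_at_0:
  assumes I: "ito_integral M F T W H I" and \<epsilon>: "0 < \<epsilon>"
  shows "AE \<omega> in M. \<bar>I 0 \<omega>\<bar> \<le> \<epsilon>"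
proof -
  obtain m \<tau> \<xi> where el: "\<And>k. elementary F T (m k) (\<tau> k) (\<xi> k)"
    and lim: "tends_to_0_in_prob M
          (\<lambda>k. sup_norm T (\<lambda>t \<omega>. elementary_integral W (m k) (\<tau> k) (\<xi> k) t \<omega> - I t \<omega>))"
    using I by (auto simp: ito_integral_def)
  have zero: "elementary_integral W (m k) (\<tau> k) (\<xi> k) 0 \<omega> = 0" for k \<omega>
  proof -
    have "0 \<le> \<tau> k l" if "l \<le> m k" for l
      using el[of k] mono_on_gridD[of "m k" "\<tau> k" 0 l] that by (auto simp: elementary_def)
    then show ?thesis unfolding elementary_integral_def by (intro sum.neutral) (auto simp: min_def)
  qed
  have le: "outer_measure_of M {\<omega>\<in>space M. \<epsilon> < \<bar>I 0 \<omega>\<bar>} \<le> ennreal \<eta>" if \<eta>: "0 < \<eta>" for \<eta>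
  proof -
    obtain k where k: "outer_measure_of M {\<omega>\<in>space M. ennreal \<epsilon> <
        sup_norm T (\<lambda>t \<omega>. elementary_integral W (m k) (\<tau> k) (\<xi> k) t \<omega> - I t \<omega>) \<omega>} \<le> ennreal \<eta>"
      using tends_to_0_in_probD[OF lim \<epsilon> \<eta>] by (auto simp: eventually_sequentially)
    have "{\<omega>\<in>space M. \<epsilon> < \<bar>I 0 \<omega>\<bar>} \<subseteq> {\<omega>\<in>space M. ennreal \<epsilon> <
        sup_norm T (\<lambda>t \<omega>. elementary_integral W (m k) (\<tau> k) (\<xi> k) t \<omega> - I t \<omega>) \<omega>}"
      using horizon_pos \<epsilon> by (auto simp: sup_norm_less_iff zero ennreal_less_iff intro!: bexI[of _ 0])
    from order_trans[OF outer_measure_of_mono[OF this] k] show ?thesis .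
  qed
  have "outer_measure_of M {\<omega>\<in>space M. \<epsilon> < \<bar>I 0 \<omega>\<bar>} \<le> 0"
  proof (rule ennreal_le_epsilon)
    fix \<eta> :: real assume "0 < \<eta>"
    from le[OF this] show "outer_measure_of M {\<omega>\<in>space M. \<epsilon> < \<bar>I 0 \<omega>\<bar>} \<le> 0 + ennreal \<eta>" by simp
  qed
  moreover have I0: "I 0 \<in> borel_measurable M"
    using I horizon_pos by (intro measurable_F_M[of _ 0]) (auto simp: ito_integral_def adapted_def)
  ultimately have "emeasure M {\<omega>\<in>space M. \<epsilon> < \<bar>I 0 \<omega>\<bar>} = 0"
    by (subst (asm) outer_measure_of_eq) auto
  then show ?thesis using I0 by (subst AE_iff_measurable[OF _ refl]) (auto simp: not_le)
qed

text \<open>Splits \<open>c * e\<close> into \<open>c * H\<close> and \<open>c * (e - H)\<close>,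
  where \<open>e\<close> is the elementary process, at the price of factors 2. A pathwise bound for
  the weighted integrand thus passes to the approximation, up to an error that contains
  \<open>B\<close> but is small for a good approximation.\<close>

lemma nn_integral_weighted_elementary_le:
  fixes t :: "nat \<Rightarrow> real" and c :: "nat \<Rightarrow> real" and C B :: real
  assumes H: "jointly_measurable M T H" and \<omega>: "\<omega> \<in> space M"
    and t: "\<And>i. i < J \<Longrightarrow> t i \<le> t (Suc i)"
    and B: "\<And>i. i < J \<Longrightarrow> \<bar>c i\<bar> \<le> B"
    and C: "\<And>i s. i < J \<Longrightarrow> s \<in> {t i<..t (Suc i)} \<Longrightarrow> (c i * H s \<omega>)\<^sup>2 \<le> C" "0 \<le> C"
    and \<eta>: "(\<integral>\<^sup>+ s\<in>{0..T}. ennreal ((elementary_process m \<tau> \<xi> s \<omega> - H s \<omega>)\<^sup>2) \<partial>lborel) \<le> ennreal \<eta>"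
      "0 \<le> \<eta>"
  shows "(\<integral>\<^sup>+ s\<in>{0..T}. ennreal (((\<Sum>i<J. c i * indicator {t i<..t (Suc i)} s)
         * elementary_process m \<tau> \<xi> s \<omega>)\<^sup>2) \<partial>lborel) \<le> ennreal (2 * C * T + 2 * B\<^sup>2 * \<eta>)"
proof -
  define h where "h s = indicator {0..T} s * H s \<omega>" for s
  let ?e = "\<lambda>s. elementary_process m \<tau> \<xi> s \<omega>"
  have h[measurable]: "h \<in> borel_measurable borel"
    using borel_measurable_section[OF H \<omega>] by (simp add: h_def[abs_def])
  have "(\<integral>\<^sup>+ s\<in>{0..T}. ennreal (((\<Sum>i<J. c i * indicator {t i<..t (Suc i)} s) * ?e s)\<^sup>2) \<partial>lborel)
    \<le> (\<integral>\<^sup>+ s. (ennreal (2 * C) * indicator {0..T} s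
        + ennreal (2 * B\<^sup>2) * (ennreal ((?e s - h s)\<^sup>2) * indicator {0..T} s)) \<partial>lborel)"
  proof (rule nn_integral_mono)
    fix s :: real
    let ?c = "\<Sum>i<J. c i * indicator {t i<..t (Suc i)} s"
    have "(?c * ?e s)\<^sup>2 \<le> 2 * C + 2 * B\<^sup>2 * (?e s - H s \<omega>)\<^sup>2"
    proof (cases "\<exists>i<J. s \<in> {t i<..t (Suc i)}")
      case True
      then obtain i where i: "i < J" "s \<in> {t i<..t (Suc i)}" by auto
      then have c: "?c = c i" by (intro sum_grid_indicator t) auto
      have "(c i * ?e s)\<^sup>2 = (c i * H s \<omega> + c i * (?e s - H s \<omega>))\<^sup>2" by (simp add: algebra_simps)
      also have "\<dots> \<le> 2 * (c i * H s \<omega>)\<^sup>2 + 2 * (c i * (?e s - H s \<omega>))\<^sup>2"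
        using sum_squares_bound[of "c i * H s \<omega>" "c i * (?e s - H s \<omega>)"] unfolding power2_sum by linarith
      also have "\<dots> \<le> 2 * C + 2 * (B\<^sup>2 * (?e s - H s \<omega>)\<^sup>2)"
        using C(1)[OF i] power_mono[OF B[OF i(1)] abs_ge_zero, of 2]
        by (auto simp: power_mult_distrib intro!: add_mono mult_right_mono)
      finally show ?thesis by (simp add: c)
    next
      case False
      then have "?c = 0" by (intro sum.neutral) auto
      then show ?thesis using C(2) by simp
    qed
    then have "ennreal ((?c * ?e s)\<^sup>2) \<le> ennreal (2 * C) + ennreal (2 * B\<^sup>2) * ennreal ((?e s - H s \<omega>)\<^sup>2)"
      using C(2) by (simp add: ennreal_plus[symmetric] ennreal_mult[symmetric] del: ennreal_plus)
    then show "ennreal ((?c * ?e s)\<^sup>2) * indicator {0..T} s \<le> ennreal (2 * C) * indicator {0..T} s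
        + ennreal (2 * B\<^sup>2) * (ennreal ((?e s - h s)\<^sup>2) * indicator {0..T} s)"
      by (auto simp: h_def indicator_def)
  qed
  also have "\<dots> = ennreal (2 * C) * ennreal T
      + ennreal (2 * B\<^sup>2) * (\<integral>\<^sup>+ s\<in>{0..T}. ennreal ((?e s - h s)\<^sup>2) \<partial>lborel)"
    using horizon_pos by (simp add: nn_integral_add nn_integral_cmult nn_integral_cmult_indicator)
  also have "(\<integral>\<^sup>+ s\<in>{0..T}. ennreal ((?e s - h s)\<^sup>2) \<partial>lborel)
      = (\<integral>\<^sup>+ s\<in>{0..T}. ennreal ((?e s - H s \<omega>)\<^sup>2) \<partial>lborel)"
    by (intro nn_integral_cong) (auto simp: h_def indicator_def)
  also have "ennreal (2 * C) * ennreal T + ennreal (2 * B\<^sup>2) * \<dots>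
      \<le> ennreal (2 * C) * ennreal T + ennreal (2 * B\<^sup>2) * ennreal \<eta>"
    by (intro add_left_mono mult_left_mono \<eta>) auto
  also have "\<dots> = ennreal (2 * C * T + 2 * B\<^sup>2 * \<eta>)"
    using C(2) \<eta>(2) horizon_pos by (simp add: ennreal_plus[symmetric] ennreal_mult[symmetric] del: ennreal_plus)
  finally show ?thesis .
qed

text \<open>Where \<open>c * H\<close> is small, a good elementary approximation has weighted
  quadratic variation at most \<open>3 * C * T\<close>, and its tail bound carries over.
  \<open>B\<close> and \<open>J\<close> only decide how good the approximation has to be, so the
  final bound is uniform in both.\<close>

lemma ito_integral_grid_tail:
  fixes W I :: "real \<Rightarrow> 'a \<Rightarrow> real" and t :: "nat \<Rightarrow> real" and c :: "nat \<Rightarrow> 'a \<Rightarrow> real" and J :: nat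
  defines "Y \<equiv> \<lambda>i \<omega>. c i \<omega> * (I (t (Suc i)) \<omega> - I (t i) \<omega>)"
  assumes W: "brownian_motion M F T W" and I: "ito_integral M F T W H I"
    and t: "0 \<le> t 0" "t J \<le> T" "\<And>i. i < J \<Longrightarrow> t i \<le> t (Suc i)"
    and c: "\<And>i. i < J \<Longrightarrow> c i \<in> borel_measurable (F (t i))"
    and B: "\<And>i \<omega>. i < J \<Longrightarrow> \<omega> \<in> space M \<Longrightarrow> \<bar>c i \<omega>\<bar> \<le> B" "0 < B"
    and K: "0 < K" and C: "0 < C"
  shows "outer_measure_of M {\<omega> \<in> space M. K < (\<Sum>i<J. Y i \<omega>)\<^sup>2 + (\<Sum>i<J. (Y i \<omega>)\<^sup>2)}
    \<le> outer_measure_of M {\<omega> \<in> space M. \<exists>i<J. \<exists>s\<in>{t i<..t (Suc i)}. C < (c i \<omega> * H s \<omega>)\<^sup>2}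
      + ennreal (24 * C * T / K)"
proof (rule ennreal_le_epsilon)
  fix \<eta> :: real assume \<eta>: "0 < \<eta>"
  let ?bad = "{\<omega> \<in> space M. \<exists>i<J. \<exists>s\<in>{t i<..t (Suc i)}. C < (c i \<omega> * H s \<omega>)\<^sup>2}"
  obtain m \<tau> \<xi> where el: "\<And>k. elementary F T (m k) (\<tau> k) (\<xi> k)"
    and lim1: "tends_to_0_in_prob M
          (\<lambda>k \<omega>. \<integral>\<^sup>+ s\<in>{0..T}.
             ennreal ((elementary_process (m k) (\<tau> k) (\<xi> k) s \<omega> - H s \<omega>)\<^sup>2) \<partial>lborel)"
    and lim2: "tends_to_0_in_prob M
          (\<lambda>k. sup_norm T (\<lambda>t \<omega>. elementary_integral W (m k) (\<tau> k) (\<xi> k) t \<omega> - I t \<omega>))"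
    and H: "jointly_measurable M T H"
    using I by (auto simp: ito_integral_def)
  \<comment> \<open>\<open>\<eta>1\<close> makes \<open>2 * B^2 * \<eta>1 = C * T\<close>.
    \<open>\<gamma>\<close> is the admissible error of one weighted increment; the summand 1 avoids
    a division by zero for \<open>J = 0\<close>. An error \<open>\<eta>2\<close> at both ends of a
    cell, times the weight bound \<open>B\<close>, gives exactly \<open>\<gamma>\<close>.\<close>
  define \<eta>1 where "\<eta>1 = C * T / (2 * B\<^sup>2)"
  define \<gamma> where "\<gamma> = sqrt (K / (4 * ((real J)\<^sup>2 + real J + 1)))"
  define \<eta>2 where "\<eta>2 = \<gamma> / (2 * B)"
  have Jpos: "0 < (real J)\<^sup>2 + real J + 1" by (intro add_nonneg_pos) auto
  have \<eta>1: "0 < \<eta>1" using C horizon_pos B(2) by (simp add: \<eta>1_def)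
  have \<gamma>: "0 < \<gamma>" "((real J)\<^sup>2 + real J) * \<gamma>\<^sup>2 \<le> K / 4"
    using K Jpos by (auto simp: \<gamma>_def field_simps)
  have \<eta>2: "0 < \<eta>2" using \<gamma> B(2) by (simp add: \<eta>2_def)
  define X1 where "X1 k = {\<omega>\<in>space M. ennreal \<eta>1 < (\<integral>\<^sup>+ s\<in>{0..T}.
             ennreal ((elementary_process (m k) (\<tau> k) (\<xi> k) s \<omega> - H s \<omega>)\<^sup>2) \<partial>lborel)}" for k
  define X2 where "X2 k = {\<omega>\<in>space M. ennreal \<eta>2 <
    sup_norm T (\<lambda>t \<omega>. elementary_integral W (m k) (\<tau> k) (\<xi> k) t \<omega> - I t \<omega>) \<omega>}" for k
  have "\<forall>\<^sub>F k in sequentially. outer_measure_of M (X1 k) \<le> ennreal (\<eta> / 2)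
      \<and> outer_measure_of M (X2 k) \<le> ennreal (\<eta> / 2)"
    unfolding X1_def X2_def
    using \<eta> by (intro eventually_conj tends_to_0_in_probD[OF lim1 \<eta>1] tends_to_0_in_probD[OF lim2 \<eta>2]) auto
  then obtain k where k: "outer_measure_of M (X1 k) \<le> ennreal (\<eta> / 2)" "outer_measure_of M (X2 k) \<le> ennreal (\<eta> / 2)"
    by (auto simp: eventually_sequentially)
  define N where "N = elementary_integral W (m k) (\<tau> k) (\<xi> k)"
  define Y' where "Y' i \<omega> = c i \<omega> * (N (t (Suc i)) \<omega> - N (t i) \<omega>)" for i \<omega>
  \<comment> \<open>\<open>2 * C * T\<close> from the integrand and \<open>C * T\<close> from the
    approximation error. With the threshold \<open>K / 4\<close> the elementary bound becomes
    \<open>2 * r / (K / 4) = 24 * C * T / K\<close>.\<close>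
  define r where "r = 3 * C * T"
  define X3 where "X3 = {\<omega> \<in> space M. K / 4 < (\<Sum>i<J. Y' i \<omega>)\<^sup>2 + (\<Sum>i<J. (Y' i \<omega>)\<^sup>2)
    \<and> (\<integral>\<^sup>+ s\<in>{0..T}. ennreal (((\<Sum>i<J. c i \<omega> * indicator {t i<..t (Suc i)} s)
         * elementary_process (m k) (\<tau> k) (\<xi> k) s \<omega>)\<^sup>2) \<partial>lborel) \<le> ennreal r}"
  have r: "0 \<le> r" "2 * C * T + 2 * B\<^sup>2 * \<eta>1 = r" using C horizon_pos B(2) by (auto simp: r_def \<eta>1_def)
  have X3: "outer_measure_of M X3 \<le> ennreal (2 * r / (K / 4))"
    unfolding X3_def Y'_def N_def
    by (rule elementary_integral_grid_tail[OF W el t c B(1) _ r(1)]) (use K in auto)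
  have "\<omega> \<in> (?bad \<union> X3) \<union> (X1 k \<union> X2 k)"
    if \<omega>: "\<omega> \<in> space M" and big: "K < (\<Sum>i<J. Y i \<omega>)\<^sup>2 + (\<Sum>i<J. (Y i \<omega>)\<^sup>2)" for \<omega>
  proof (rule ccontr)
    assume "\<omega> \<notin> (?bad \<union> X3) \<union> (X1 k \<union> X2 k)"
    then have nb: "\<omega> \<notin> ?bad" and n1: "\<omega> \<notin> X1 k" and n2: "\<omega> \<notin> X2 k" and n3: "\<omega> \<notin> X3" by auto
    have "(\<integral>\<^sup>+ s\<in>{0..T}. ennreal (((\<Sum>i<J. c i \<omega> * indicator {t i<..t (Suc i)} s)
         * elementary_process (m k) (\<tau> k) (\<xi> k) s \<omega>)\<^sup>2) \<partial>lborel) \<le> ennreal r"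
      unfolding r(2)[symmetric]
    proof (rule nn_integral_weighted_elementary_le[OF H \<omega>, where c="\<lambda>i. c i \<omega>"])
      show "(\<integral>\<^sup>+ s\<in>{0..T}. ennreal ((elementary_process (m k) (\<tau> k) (\<xi> k) s \<omega> - H s \<omega>)\<^sup>2) \<partial>lborel)
          \<le> ennreal \<eta>1"
        using n1 \<omega> by (simp add: X1_def not_less)
      show "(c i \<omega> * H s \<omega>)\<^sup>2 \<le> C" if "i < J" "s \<in> {t i<..t (Suc i)}" for i s
        using nb \<omega> that by (metis (mono_tags, lifting) mem_Collect_eq not_less)
    qed (use \<omega> C \<eta>1 t(3) B(1) in auto)
    with n3 \<omega> have small: "(\<Sum>i<J. Y' i \<omega>)\<^sup>2 + (\<Sum>i<J. (Y' i \<omega>)\<^sup>2) \<le> K / 4"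
      by (auto simp: X3_def not_less)
    have NI: "\<bar>N u \<omega> - I u \<omega>\<bar> \<le> \<eta>2" if "u \<in> {0..T}" for u
      using n2 \<omega> not_less_sup_normD[OF _ that, of \<eta>2] \<eta>2 by (auto simp: X2_def N_def)
    have E: "\<bar>Y i \<omega> - Y' i \<omega>\<bar> \<le> \<gamma>" if i: "i < J" for i
    proof -
      have "t i \<in> {0..T}" "t (Suc i) \<in> {0..T}"
        using mono_on_gridD[of J t, OF t(3), of 0 i] mono_on_gridD[of J t, OF t(3), of 0 "Suc i"]
          mono_on_gridD[of J t, OF t(3), of i J] mono_on_gridD[of J t, OF t(3), of "Suc i" J] i t(1,2) by auto
      from NI[OF this(1)] NI[OF this(2)]
      have "\<bar>(I (t (Suc i)) \<omega> - I (t i) \<omega>) - (N (t (Suc i)) \<omega> - N (t i) \<omega>)\<bar> \<le> 2 * \<eta>2" by linarith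
      then have "\<bar>c i \<omega>\<bar> * \<bar>(I (t (Suc i)) \<omega> - I (t i) \<omega>) - (N (t (Suc i)) \<omega> - N (t i) \<omega>)\<bar> \<le> B * (2 * \<eta>2)"
        using B \<omega> i by (intro mult_mono) auto
      also have "B * (2 * \<eta>2) = \<gamma>" using B(2) by (simp add: \<eta>2_def)
      finally show ?thesis by (simp add: Y_def Y'_def right_diff_distrib[symmetric] abs_mult[symmetric])
    qed
    have sq: "x\<^sup>2 \<le> 2 * y\<^sup>2 + 2 * g\<^sup>2" if "\<bar>x - y\<bar> \<le> g" for x y g :: real
    proof -
      have "x\<^sup>2 = (y + (x - y))\<^sup>2" by simp
      also have "\<dots> \<le> 2 * y\<^sup>2 + 2 * (x - y)\<^sup>2"
        using sum_squares_bound[of y "x - y"] unfolding power2_sum by linarith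
      also have "(x - y)\<^sup>2 \<le> g\<^sup>2" using power_mono[OF that abs_ge_zero, of 2] by simp
      finally show ?thesis by simp
    qed
    \<comment> \<open>The total is off by at most \<open>J * \<gamma>\<close> and each term by
      \<open>\<gamma>\<close>, which explains \<open>J^2 + J\<close> in the choice of
      \<open>\<gamma>\<close>. Squaring doubles both parts, so each may be at most
      \<open>K / 4\<close>.\<close>
    have "\<bar>(\<Sum>i<J. Y i \<omega>) - (\<Sum>i<J. Y' i \<omega>)\<bar> \<le> (\<Sum>i<J. \<bar>Y i \<omega> - Y' i \<omega>\<bar>)"
      unfolding sum_subtractf[symmetric] by (rule sum_abs)
    also have "\<dots> \<le> real J * \<gamma>" using sum_bounded_above[of "{..<J}" _ \<gamma>] E by simp
    finally have "(\<Sum>i<J. Y i \<omega>)\<^sup>2 \<le> 2 * (\<Sum>i<J. Y' i \<omega>)\<^sup>2 + 2 * (real J * \<gamma>)\<^sup>2" by (rule sq)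
    moreover have "(\<Sum>i<J. (Y i \<omega>)\<^sup>2) \<le> (\<Sum>i<J. 2 * (Y' i \<omega>)\<^sup>2 + 2 * \<gamma>\<^sup>2)"
      using E by (intro sum_mono sq) auto
    ultimately have "(\<Sum>i<J. Y i \<omega>)\<^sup>2 + (\<Sum>i<J. (Y i \<omega>)\<^sup>2)
        \<le> 2 * ((\<Sum>i<J. Y' i \<omega>)\<^sup>2 + (\<Sum>i<J. (Y' i \<omega>)\<^sup>2)) + 2 * (((real J)\<^sup>2 + real J) * \<gamma>\<^sup>2)"
      by (simp add: sum.distrib sum_distrib_left[symmetric] power_mult_distrib algebra_simps)
    also have "\<dots> \<le> 2 * (K / 4) + 2 * (K / 4)"
      using small \<gamma>(2) by (intro add_mono mult_left_mono) auto
    finally show False using big by simp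
  qed
  then have "outer_measure_of M {\<omega> \<in> space M. K < (\<Sum>i<J. Y i \<omega>)\<^sup>2 + (\<Sum>i<J. (Y i \<omega>)\<^sup>2)}
      \<le> outer_measure_of M (?bad \<union> X3) + outer_measure_of M (X1 k \<union> X2 k)"
    by (intro outer_measure_of_union_le) (auto simp: X1_def X2_def X3_def)
  also have "\<dots> \<le> (outer_measure_of M ?bad + outer_measure_of M X3) + (outer_measure_of M (X1 k) + outer_measure_of M (X2 k))"
    by (intro add_mono outer_measure_of_union_le) (auto simp: X1_def X2_def X3_def)
  also have "\<dots> \<le> (outer_measure_of M ?bad + ennreal (2 * r / (K / 4))) + (ennreal (\<eta> / 2) + ennreal (\<eta> / 2))"
    by (intro add_mono k X3 order_refl)
  also have "ennreal (\<eta> / 2) + ennreal (\<eta> / 2) = ennreal \<eta>"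
    using \<eta> by (simp add: ennreal_plus[symmetric] del: ennreal_plus)
  also have "2 * r / (K / 4) = 24 * C * T / K" by (simp add: r_def)
  finally show "outer_measure_of M {\<omega> \<in> space M. K < (\<Sum>i<J. Y i \<omega>)\<^sup>2 + (\<Sum>i<J. (Y i \<omega>)\<^sup>2)}
    \<le> outer_measure_of M ?bad + ennreal (24 * C * T / K) + ennreal \<eta>" .
qed

end

section \<open>The logarithmic estimate along a time grid\<close>

text \<open>\<open>e\<close> stands for the drift increment, \<open>d\<close> for the stochastic
  one. Second-order drift terms cost up to \<open>2 * \<rho>^2 / \<delta>\<close> per step; this
  depends on \<delta>, but \<open>\<rho>\<close> will be proportional to the mesh, so their sum
  vanishes as the grid is refined. The second-order stochastic terms do not vanish and are kept with
  their weight.\<close>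

lemma ln_square_grid_bound:
  fixes v e d :: "nat \<Rightarrow> real"
  assumes \<delta>: "0 < \<delta>"
    and step: "\<And>i. i < n \<Longrightarrow> v (Suc i) - v i = e i + d i"
    and drift: "\<And>i. i < n \<Longrightarrow> 2 * v i * e i \<le> \<kappa> * ((v i)\<^sup>2 + \<delta>)"
    and small: "\<And>i. i < n \<Longrightarrow> \<bar>e i\<bar> \<le> \<rho>"
  shows "ln ((v n)\<^sup>2 + \<delta>) \<le> ln ((v 0)\<^sup>2 + \<delta>) + real n * (\<kappa> + 2 * \<rho>\<^sup>2 / \<delta>)
    + (\<Sum>i<n. 2 * v i / ((v i)\<^sup>2 + \<delta>) * d i) + 2 * (\<Sum>i<n. (1 / sqrt ((v i)\<^sup>2 + \<delta>) * d i)\<^sup>2)"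
  using step drift small
proof (induction n)
  case (Suc n)
  let ?q = "(v n)\<^sup>2 + \<delta>"
  have q: "0 < ?q" "0 < (v (Suc n))\<^sup>2 + \<delta>" using \<delta> by (auto intro: add_nonneg_pos)
  have "ln ((v (Suc n))\<^sup>2 + \<delta>) - ln ?q \<le> ((v (Suc n))\<^sup>2 - (v n)\<^sup>2) / ?q"
    using ln_diff_le[OF q(2) q(1)] by simp
  also have "(v (Suc n))\<^sup>2 - (v n)\<^sup>2 = 2 * v n * e n + 2 * v n * d n + (e n + d n)\<^sup>2"
  proof -
    have "v (Suc n) = v n + (e n + d n)" using Suc.prems(1)[of n] by simp
    then show ?thesis by (simp add: power2_eq_square algebra_simps)
  qed
  also have "\<dots> / ?q \<le> (\<kappa> * ?q + 2 * v n * d n + (2 * \<rho>\<^sup>2 + 2 * (d n)\<^sup>2)) / ?q"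
  proof (intro divide_right_mono add_mono)
    have "(e n + d n)\<^sup>2 \<le> 2 * (e n)\<^sup>2 + 2 * (d n)\<^sup>2"
      using sum_squares_bound[of "e n" "d n"] unfolding power2_sum by linarith
    also have "(e n)\<^sup>2 \<le> \<rho>\<^sup>2"
      using power_mono[OF Suc.prems(3)[of n] abs_ge_zero, of 2] by simp
    finally show "(e n + d n)\<^sup>2 \<le> 2 * \<rho>\<^sup>2 + 2 * (d n)\<^sup>2" by simp
  qed (use Suc.prems(2)[of n] q in auto)
  also have "\<dots> = \<kappa> + 2 * v n / ?q * d n + 2 * \<rho>\<^sup>2 / ?q + 2 * (1 / sqrt ?q * d n)\<^sup>2"
    using q by (simp add: add_divide_distrib power_mult_distrib power_divide real_sqrt_pow2 less_imp_le)
  also have "2 * \<rho>\<^sup>2 / ?q \<le> 2 * \<rho>\<^sup>2 / \<delta>"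
    using \<delta> by (intro divide_left_mono mult_pos_pos q) auto
  finally have "ln ((v (Suc n))\<^sup>2 + \<delta>) \<le> ln ?q + (\<kappa> + 2 * \<rho>\<^sup>2 / \<delta>)
      + 2 * v n / ?q * d n + 2 * (1 / sqrt ?q * d n)\<^sup>2" by linarith
  moreover have "ln ?q \<le> ln ((v 0)\<^sup>2 + \<delta>) + real n * (\<kappa> + 2 * \<rho>\<^sup>2 / \<delta>)
    + (\<Sum>i<n. 2 * v i / ((v i)\<^sup>2 + \<delta>) * d i) + 2 * (\<Sum>i<n. (1 / sqrt ((v i)\<^sup>2 + \<delta>) * d i)\<^sup>2)"
    using Suc.prems by (intro Suc.IH) auto
  moreover have "real (Suc n) * (\<kappa> + 2 * \<rho>\<^sup>2 / \<delta>) = real n * (\<kappa> + 2 * \<rho>\<^sup>2 / \<delta>) + (\<kappa> + 2 * \<rho>\<^sup>2 / \<delta>)"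
    by (simp add: distrib_right)
  ultimately show ?case unfolding sum.lessThan_Suc distrib_left by linarith
qed simp

section \<open>Tools for the drift, the stopping and the oscillation of paths\<close>

lemma set_integral_le_const:
  fixes a b C :: real
  assumes "set_integrable lborel {a<..b} \<phi>" "a \<le> b" "\<And>s. s \<in> {a<..b} \<Longrightarrow> \<phi> s \<le> C"
  shows "(LINT s:{a<..b}|lborel. \<phi> s) \<le> C * (b - a)"
proof -
  have "set_integrable lborel {a<..b} (\<lambda>_. C)"
    unfolding set_integrable_def using assms(2)
    by (intro integrable_scaleR_left integrable_real_indicator) auto
  then have "(LINT s:{a<..b}|lborel. \<phi> s) \<le> (LINT s:{a<..b}|lborel. C)"
    using assms by (intro set_integral_mono) auto
  also have "\<dots> = C * (b - a)" using assms(2) by (simp add: set_lebesgue_integral_def)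
  finally show ?thesis .
qed

lemma set_integral_Icc_diff:
  fixes a b c :: real and \<phi> :: "real \<Rightarrow> real"
  assumes "set_integrable lborel {a..c} \<phi>" "a \<le> b" "b \<le> c"
  shows "(LINT s:{a..c}|lborel. \<phi> s) - (LINT s:{a..b}|lborel. \<phi> s) = (LINT s:{b<..c}|lborel. \<phi> s)"
proof -
  have un: "{a..c} = {a..b} \<union> {b<..c}" using assms by auto
  have "(LINT s:{a..b} \<union> {b<..c}|lborel. \<phi> s) = (LINT s:{a..b}|lborel. \<phi> s) + (LINT s:{b<..c}|lborel. \<phi> s)"
    using assms by (intro set_integral_Un set_integrable_subset[OF assms(1)]) auto
  then show ?thesis by (simp add: un)
qed

text \<open>The weight switches off for good once some |X j| reaches \<epsilon> and looks only at
  indices up to \<open>i\<close>; with \<open>N\<close> the \<sigma>-algebra at the left end of the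
  cell it is an admissible weight.\<close>

lemma borel_measurable_stopped:
  fixes X :: "nat \<Rightarrow> 'b \<Rightarrow> real" and \<phi> :: "real \<Rightarrow> real"
  assumes X: "\<And>j. j \<le> i \<Longrightarrow> X j \<in> borel_measurable N" and \<phi>: "\<phi> \<in> borel_measurable borel"
  shows "(\<lambda>\<omega>. if \<forall>j\<le>i. \<bar>X j \<omega>\<bar> < \<epsilon> then \<phi> (X i \<omega>) else 0) \<in> borel_measurable N"
proof (rule measurable_If)
  show "(\<lambda>\<omega>. \<phi> (X i \<omega>)) \<in> borel_measurable N"
    by (rule measurable_compose[OF X[OF order_refl] \<phi>])
  have "{\<omega> \<in> space N. \<forall>j\<in>{..i}. \<bar>X j \<omega>\<bar> < \<epsilon>} \<in> sets N"
  proof (rule sets.sets_Collect_finite_All')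
    fix j assume "j \<in> {..i}"
    then have "X j \<in> borel_measurable N" using X by simp
    then show "{\<omega> \<in> space N. \<bar>X j \<omega>\<bar> < \<epsilon>} \<in> sets N" by measurable
  qed auto
  then show "{\<omega> \<in> space N. \<forall>j\<le>i. \<bar>X j \<omega>\<bar> < \<epsilon>} \<in> sets N" by (simp only: Ball_def atMost_iff)
qed simp

text \<open>Almost every path is uniformly continuous and leaves the event once the mesh
  \<open>T / J\<close> is small enough for it; dominated convergence then gives the claim for a
  measurable version of the event.\<close>

lemma (in prob_space) grid_oscillation_tendsto_0:
  fixes V :: "real \<Rightarrow> 'a \<Rightarrow> real" and T \<delta> :: real
  assumes meas: "\<And>t. t \<in> {0..T} \<Longrightarrow> V t \<in> borel_measurable M"
    and cont: "AE \<omega> in M. continuous_on {0..T} (\<lambda>t. V t \<omega>)"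
    and T: "0 < T" and \<delta>: "0 < \<delta>"
  shows "(\<lambda>J. outer_measure_of M {\<omega> \<in> space M. \<exists>i<J. \<exists>s\<in>{real i * T / real J..real (Suc i) * T / real J}.
    \<delta> < \<bar>V s \<omega> - V (real i * T / real J) \<omega>\<bar>}) \<longlonglongrightarrow> 0"
proof -
  define Q where "Q J i = \<rat> \<inter> {real i * T / real J<..<real (Suc i) * T / real J}" for J i :: nat
  \<comment> \<open>By continuity rational times suffice, which makes the event measurable.\<close>
  define E where "E J = {\<omega> \<in> space M. \<exists>i\<in>{..<J}. \<exists>s\<in>Q J i. \<delta> < \<bar>V s \<omega> - V (real i * T / real J) \<omega>\<bar>}" for J
  have grid: "real i * T / real J \<in> {0..T}" "real i * T / real J < real (Suc i) * T / real J"
    "real (Suc i) * T / real J \<in> {0..T}" if "i < J" for i J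
  proof -
    have "real i \<le> real J" "real (Suc i) \<le> real J" using that by auto
    then show "real i * T / real J \<in> {0..T}" "real i * T / real J < real (Suc i) * T / real J"
      "real (Suc i) * T / real J \<in> {0..T}"
      using that T by (auto simp: field_simps simp del: of_nat_Suc)
  qed
  have E: "E J \<in> sets M" for J
    unfolding E_def
  proof (rule sets.sets_Collect_finite_Ex)
    fix i assume i: "i \<in> {..<J}"
    show "{\<omega> \<in> space M. \<exists>s\<in>Q J i. \<delta> < \<bar>V s \<omega> - V (real i * T / real J) \<omega>\<bar>} \<in> sets M"
    proof (rule sets.sets_Collect_countable_Ex')
      fix s assume "s \<in> Q J i"
      then have "s \<in> {0..T}" "real i * T / real J \<in> {0..T}"
        using i grid[of i J] by (auto simp: Q_def simp del: of_nat_Suc)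
      from meas[OF this(1)] meas[OF this(2)]
      show "{\<omega> \<in> space M. \<delta> < \<bar>V s \<omega> - V (real i * T / real J) \<omega>\<bar>} \<in> sets M" by measurable
    qed (simp add: Q_def countable_Int1[OF countable_rat])
  qed simp
  have "(\<lambda>J. \<integral>\<^sup>+ \<omega>. indicator (E J) \<omega> \<partial>M) \<longlonglongrightarrow> (\<integral>\<^sup>+ \<omega>. 0 \<partial>M)"
  proof (rule nn_integral_dominated_convergence[where w="\<lambda>_. 1"])
    show "AE \<omega> in M. (\<lambda>J. indicator (E J) \<omega> :: ennreal) \<longlonglongrightarrow> 0"
      using cont
    proof eventually_elim
      fix \<omega> assume "continuous_on {0..T} (\<lambda>t. V t \<omega>)"
      then have "uniformly_continuous_on {0..T} (\<lambda>t. V t \<omega>)"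
        by (intro compact_uniformly_continuous) auto
      then obtain h where h: "0 < h" "\<And>s t. s \<in> {0..T} \<Longrightarrow> t \<in> {0..T} \<Longrightarrow> dist s t < h \<Longrightarrow> dist (V s \<omega>) (V t \<omega>) < \<delta>"
        using \<delta> unfolding uniformly_continuous_on_def by metis
      obtain J0 :: nat where J0: "T / h < real J0" using reals_Archimedean2 by blast
      have "\<omega> \<notin> E J" if "J0 \<le> J" for J
      proof
        assume "\<omega> \<in> E J"
        then obtain i s where iJs: "i < J" "s \<in> Q J i" "\<delta> < \<bar>V s \<omega> - V (real i * T / real J) \<omega>\<bar>"
          by (auto simp: E_def)
        have "T < h * real J"
        proof -
          have "T < h * real J0" using J0 h(1) by (simp add: field_simps)
          also have "\<dots> \<le> h * real J" using that h(1) by simp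
          finally show ?thesis .
        qed
        then have "T / real J < h" using iJs(1) by (simp add: field_simps)
        moreover have "real (Suc i) * T / real J = real i * T / real J + T / real J"
          by (simp add: add_divide_distrib distrib_right)
        ultimately have "dist s (real i * T / real J) < h"
          using iJs(2) by (auto simp: Q_def dist_real_def simp del: of_nat_Suc)
        moreover have "s \<in> {0..T}" using iJs(2) grid[OF iJs(1)] by (auto simp: Q_def simp del: of_nat_Suc)
        ultimately show False using h(2)[OF _ grid(1)[OF iJs(1)]] iJs(3) by (force simp: dist_real_def)
      qed
      then have "\<forall>\<^sub>F J in sequentially. indicator (E J) \<omega> = (0 :: ennreal)"
        unfolding eventually_sequentially by (intro exI[of _ J0]) auto
      then show "(\<lambda>J. indicator (E J) \<omega> :: ennreal) \<longlonglongrightarrow> 0" by (rule tendsto_eventually)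
    qed
  qed (use E in \<open>auto simp: emeasure_space_1 indicator_def\<close>)
  then have lim: "(\<lambda>J. emeasure M (E J)) \<longlonglongrightarrow> 0" using E by simp
  have "outer_measure_of M {\<omega> \<in> space M. \<exists>i<J. \<exists>s\<in>{real i * T / real J..real (Suc i) * T / real J}.
    \<delta> < \<bar>V s \<omega> - V (real i * T / real J) \<omega>\<bar>} \<le> emeasure M (E J)" for J
  proof -
    have "outer_measure_of M {\<omega> \<in> space M. \<exists>i<J. \<exists>s\<in>{real i * T / real J..real (Suc i) * T / real J}.
      \<delta> < \<bar>V s \<omega> - V (real i * T / real J) \<omega>\<bar>} \<le> outer_measure_of M (E J)"
    proof (rule outer_measure_of_mono_AE)
      show "AE \<omega> in M. \<omega> \<in> {\<omega> \<in> space M. \<exists>i<J. \<exists>s\<in>{real i * T / real J..real (Suc i) * T / real J}.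
        \<delta> < \<bar>V s \<omega> - V (real i * T / real J) \<omega>\<bar>} \<longrightarrow> \<omega> \<in> E J"
        using cont
      proof eventually_elim
        fix \<omega> assume co: "continuous_on {0..T} (\<lambda>t. V t \<omega>)"
        show "\<omega> \<in> {\<omega> \<in> space M. \<exists>i<J. \<exists>s\<in>{real i * T / real J..real (Suc i) * T / real J}.
          \<delta> < \<bar>V s \<omega> - V (real i * T / real J) \<omega>\<bar>} \<longrightarrow> \<omega> \<in> E J"
        proof
          assume "\<omega> \<in> {\<omega> \<in> space M. \<exists>i<J. \<exists>s\<in>{real i * T / real J..real (Suc i) * T / real J}.
            \<delta> < \<bar>V s \<omega> - V (real i * T / real J) \<omega>\<bar>}"
          then obtain i s where \<omega>: "\<omega> \<in> space M" and i: "i < J"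
            and s: "s \<in> {real i * T / real J..real (Suc i) * T / real J}"
            and gt: "\<delta> < \<bar>V s \<omega> - V (real i * T / real J) \<omega>\<bar>" by auto
          let ?l = "real i * T / real J" and ?u = "real (Suc i) * T / real J"
          note g = grid[OF i]
          have sT: "s \<in> {0..T}" using s g(1,3) by auto
          have "continuous (at s within {0..T}) (\<lambda>t. V t \<omega>)"
            using co sT by (simp add: continuous_on_eq_continuous_within)
          \<comment> \<open>The strict inequality leaves a margin, so it persists at a rational
            point of the open cell near \<open>s\<close>, even if \<open>s\<close> is an end of the
            cell.\<close>
          moreover have "0 < \<bar>V s \<omega> - V ?l \<omega>\<bar> - \<delta>" using gt by simp
          ultimately obtain h where h: "0 < h" "\<And>x. x \<in> {0..T} \<Longrightarrow> dist x s < h \<Longrightarrow>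
              dist (V x \<omega>) (V s \<omega>) < \<bar>V s \<omega> - V ?l \<omega>\<bar> - \<delta>"
            unfolding continuous_within_eps_delta by metis
          have "max ?l (s - h) < min ?u (s + h)" using s g(2) h(1) by auto
          then obtain q where q: "q \<in> \<rat>" "max ?l (s - h) < q" "q < min ?u (s + h)"
            using Rats_dense_in_real by blast
          have "q \<in> {0..T}" using q g(1,3) by auto
          moreover have "dist q s < h" using q by (auto simp: dist_real_def)
          ultimately have "dist (V q \<omega>) (V s \<omega>) < \<bar>V s \<omega> - V ?l \<omega>\<bar> - \<delta>" by (rule h(2))
          then have "\<delta> < \<bar>V q \<omega> - V ?l \<omega>\<bar>" unfolding dist_real_def by linarith
          moreover have "q \<in> Q J i" unfolding Q_def using q by simp
          ultimately show "\<omega> \<in> E J" unfolding E_def using \<omega> i by blast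
        qed
      qed
    qed (unfold E_def, (rule Collect_restrict)+)
    also have "\<dots> = emeasure M (E J)" using E by (rule outer_measure_of_eq)
    finally show ?thesis .
  qed
  then show ?thesis
    by (intro tendsto_sandwich[OF _ _ tendsto_const lim] always_eventually allI zero_le)
qed

text \<open>\<open>f x - |L| * x\<close> is nonincreasing in \<open>x\<close>, so on [-r, r] it is
  controlled by its values at the two ends; this takes the place of continuity.\<close>

lemma one_sided_Lipschitz_locally_bounded:
  fixes f :: "real \<Rightarrow> real"
  assumes "\<And>x y. (x - y) * (f x - f y) \<le> L * \<bar>x - y\<bar>\<^sup>2"
  shows "\<exists>C\<ge>0. \<forall>x. \<bar>x\<bar> \<le> r \<longrightarrow> \<bar>f x\<bar> \<le> C"
proof (intro exI conjI allI impI)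
  have le: "f x - f y \<le> \<bar>L\<bar> * (x - y)" if "y \<le> x" for x y
  proof (cases "y = x")
    case False
    then have "0 < x - y" using that by simp
    moreover have "(x - y) * (f x - f y) \<le> (x - y) * (\<bar>L\<bar> * (x - y))"
    proof -
      have "(x - y) * (f x - f y) \<le> L * \<bar>x - y\<bar>\<^sup>2" by (rule assms)
      also have "\<dots> \<le> \<bar>L\<bar> * \<bar>x - y\<bar>\<^sup>2" by (intro mult_right_mono) auto
      also have "\<dots> = (x - y) * (\<bar>L\<bar> * (x - y))" by (simp add: power2_eq_square)
      finally show ?thesis .
    qed
    ultimately show ?thesis by simp
  qed simp
  let ?C = "\<bar>f r\<bar> + \<bar>f (- r)\<bar> + \<bar>L\<bar> * (2 * \<bar>r\<bar>)"
  show "0 \<le> ?C" by simp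
  fix x assume x: "\<bar>x\<bar> \<le> r"
  have "\<bar>L\<bar> * (x + r) \<le> \<bar>L\<bar> * (2 * \<bar>r\<bar>)" "\<bar>L\<bar> * (r - x) \<le> \<bar>L\<bar> * (2 * \<bar>r\<bar>)"
    using x by (auto intro!: mult_left_mono)
  then show "\<bar>f x\<bar> \<le> ?C"
    using le[of "- r" x] le[of x r] x by (auto simp: abs_le_iff)
qed

text \<open>Lets \<open>U s\<close> be replaced by \<open>V\<close> at the left end of its cell: for
  \<delta> \<le> 1 the squared error \<open>4 * \<delta>^2\<close> is absorbed by the regularising
  \<delta>.\<close>

lemma square_le_near:
  fixes u v \<delta> :: real
  assumes "\<bar>u - v\<bar> \<le> 2 * \<delta>" "0 \<le> \<delta>" "\<delta> \<le> 1"
  shows "u\<^sup>2 \<le> 8 * (v\<^sup>2 + \<delta>)"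
proof -
  have "u\<^sup>2 = (v + (u - v))\<^sup>2" by simp
  also have "\<dots> \<le> 2 * v\<^sup>2 + 2 * (u - v)\<^sup>2"
    using sum_squares_bound[of v "u - v"] unfolding power2_sum by linarith
  also have "(u - v)\<^sup>2 \<le> (2 * \<delta>)\<^sup>2" using power_mono[OF assms(1) abs_ge_zero, of 2] by simp
  also have "(2 * \<delta>)\<^sup>2 \<le> 4 * \<delta>"
    using mult_left_mono[OF assms(3), of \<delta>] assms(2) by (simp add: power2_eq_square)
  finally have "u\<^sup>2 \<le> 2 * v\<^sup>2 + 8 * \<delta>" by simp
  moreover have "0 \<le> v\<^sup>2" by simp
  ultimately show ?thesis unfolding distrib_left by linarith
qed

text \<open>The argument for a single path. The sums in \<open>mart\<close> are stopped at the first
  grid time outside the band, \<open>fine\<close> makes the second-order drift terms add up to at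
  most 1, and \<open>small\<close> says that the resulting growth factor does not lift
  \<open>2 * \<delta>\<close> above \<epsilon>^2. The range |x| \<le> 3 for \<open>C\<close> comes
  from |u| \<le> \<epsilon> + 2 \<delta> \<le> 3 \<epsilon> \<le> 3 on cells that start inside the
  band.\<close>

lemma grid_solution_bound:
  fixes u a I :: "real \<Rightarrow> real" and f :: "real \<Rightarrow> real" and \<delta> \<epsilon> K \<kappa> C L T :: real and J :: nat
  defines "t \<equiv> \<lambda>i. real i * T / real J"
    and "v \<equiv> \<lambda>s. u s - a s"
    and "\<kappa> \<equiv> 16 * L + 4 * C"
  defines "\<phi> \<equiv> \<lambda>i. \<forall>j\<le>i. \<bar>v (t j)\<bar> < \<epsilon>"
  assumes T: "0 < T" and J: "0 < J" and L: "0 < L" and C: "0 \<le> C"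
    and f: "\<And>x. x * f x \<le> L * x\<^sup>2" "\<And>x. \<bar>x\<bar> \<le> 3 \<Longrightarrow> \<bar>f x\<bar> \<le> C"
    and eq: "\<And>s. s \<in> {0..T} \<Longrightarrow> u s = a s + (LINT r:{0..s}|lborel. f (u r)) + I s"
    and int: "set_integrable lborel {0..T} (\<lambda>s. f (u s))"
    and I0: "\<bar>I 0\<bar> \<le> \<delta>"
    and a: "\<And>s. s \<in> {0..T} \<Longrightarrow> \<bar>a s\<bar> \<le> \<delta>"
    and osc: "\<And>i s. i < J \<Longrightarrow> s \<in> {t i..t (Suc i)} \<Longrightarrow> \<bar>v s - v (t i)\<bar> \<le> \<delta>"
    and \<delta>: "0 < \<delta>" "\<delta> \<le> \<epsilon>" "\<epsilon> \<le> 1"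
    and mart: "(\<Sum>i<J. (if \<phi> i then 2 * v (t i) / ((v (t i))\<^sup>2 + \<delta>) else 0) * (I (t (Suc i)) - I (t i))) \<le> K"
      "(\<Sum>i<J. ((if \<phi> i then 1 / sqrt ((v (t i))\<^sup>2 + \<delta>) else 0) * (I (t (Suc i)) - I (t i)))\<^sup>2) \<le> K"
    and fine: "2 * (C * T)\<^sup>2 \<le> real J * \<delta>"
    and small: "2 * \<delta> * exp (\<kappa> * T + 1 + 3 * K) \<le> \<epsilon>\<^sup>2"
    and s: "s \<in> {0..T}"
  shows "\<bar>u s\<bar> \<le> 3 * \<epsilon>"
proof -
  define h where "h = T / real J"
  define D where "D s = (LINT r:{0..s}|lborel. f (u r))" for s
  have h: "0 < h" "t (Suc i) - t i = h" for i
    using T J by (auto simp: h_def t_def add_divide_distrib distrib_right)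
  have t0: "t 0 = 0" "t J = T" using J by (auto simp: t_def)
  have t_mono: "t i \<le> t j" if "i \<le> j" for i j
    using that T unfolding t_def by (intro divide_right_mono mult_right_mono) auto
  have tT: "t i \<in> {0..T}" if "i \<le> J" for i
    using t_mono[of 0 i] t_mono[OF that] t0 by auto
  have grid: "{t i..t (Suc i)} \<subseteq> {0..T}" if "i < J" for i
    using tT[of i] tT[of "Suc i"] that by auto
  have v: "v s = D s + I s" if "s \<in> {0..T}" for s
    using eq[OF that] by (simp add: v_def D_def)
  have near: "\<bar>u s - v (t i)\<bar> \<le> 2 * \<delta>" if "i < J" "s \<in> {t i..t (Suc i)}" for i s
    using osc[OF that] a[of s] grid[OF that(1)] that(2) unfolding v_def by force
  have step: "2 * v (t i) * (D (t (Suc i)) - D (t i)) \<le> \<kappa> * h * ((v (t i))\<^sup>2 + \<delta>)"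
    "\<bar>D (t (Suc i)) - D (t i)\<bar> \<le> C * h" if i: "i < J" "\<bar>v (t i)\<bar> < \<epsilon>" for i
  proof -
    let ?S = "{t i<..t (Suc i)}" and ?v = "v (t i)"
    have le: "t i \<le> t (Suc i)" by (rule t_mono) simp
    have sub: "set_integrable lborel ?S (\<lambda>s. f (u s))"
      by (rule set_integrable_subset[OF int]) (use grid[OF i(1)] in force)+
    have diff: "D (t (Suc i)) - D (t i) = (LINT s:?S|lborel. f (u s))"
      unfolding D_def using tT[of i] tT[of "Suc i"] i(1) le
      by (intro set_integral_Icc_diff set_integrable_subset[OF int]) auto
    have fb: "\<bar>f (u s)\<bar> \<le> C" if "s \<in> ?S" for s
      using near[OF i(1), of s] i(2) that \<delta> by (intro f(2)) auto
    \<comment> \<open>In \<open>v * f u = u * f u - (u - v) * f u\<close> the first term is at most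
      \<open>8 * L * (v^2 + \<delta>)\<close> and the second contributes at most
      \<open>2 * C * \<delta>\<close>; doubling gives \<open>\<kappa>\<close>.\<close>
    have "2 * ?v * f (u s) \<le> \<kappa> * (?v\<^sup>2 + \<delta>)" if s: "s \<in> ?S" for s
    proof -
      have n: "\<bar>u s - ?v\<bar> \<le> 2 * \<delta>" using near[OF i(1), of s] s by auto
      have "\<bar>(u s - ?v) * f (u s)\<bar> \<le> 2 * \<delta> * C"
        unfolding abs_mult using n fb[OF s] \<delta> by (intro mult_mono) auto
      moreover have "u s * f (u s) \<le> L * (8 * (?v\<^sup>2 + \<delta>))"
        using \<delta> L by (intro order_trans[OF f(1)] mult_left_mono square_le_near[OF n]) auto
      ultimately have "?v * f (u s) \<le> L * (8 * (?v\<^sup>2 + \<delta>)) + 2 * \<delta> * C"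
        by (simp add: left_diff_distrib abs_le_iff)
      moreover have "0 \<le> C * ?v\<^sup>2" using C by simp
      ultimately show ?thesis by (simp add: \<kappa>_def algebra_simps)
    qed
    then have "(LINT s:?S|lborel. 2 * ?v * f (u s)) \<le> \<kappa> * (?v\<^sup>2 + \<delta>) * (t (Suc i) - t i)"
      using sub le by (intro set_integral_le_const) auto
    then show "2 * ?v * (D (t (Suc i)) - D (t i)) \<le> \<kappa> * h * (?v\<^sup>2 + \<delta>)"
      by (simp add: diff h(2) mult.commute mult.left_commute)
    have "(LINT s:?S|lborel. f (u s)) \<le> C * h"
      unfolding h(2)[of i, symmetric] using sub le fb by (intro set_integral_le_const) (auto simp: abs_le_iff)
    moreover have "(LINT s:?S|lborel. - f (u s)) \<le> C * h"
      unfolding h(2)[of i, symmetric] using sub le fb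
      by (intro set_integral_le_const) (auto simp: abs_le_iff set_integrable_def)
    moreover have "(LINT s:?S|lborel. - f (u s)) = - (LINT s:?S|lborel. f (u s))"
      by (simp add: set_lebesgue_integral_def)
    ultimately show "\<bar>D (t (Suc i)) - D (t i)\<bar> \<le> C * h"
      unfolding diff by (simp add: abs_le_iff)
  qed
  have in_band: "\<bar>v (t i)\<bar> < \<epsilon>" if "i \<le> J" for i
  proof (rule ccontr)
    assume i: "\<not> \<bar>v (t i)\<bar> < \<epsilon>"
    \<comment> \<open>At the first exit index \<open>n\<close> the stopping condition holds exactly
      for the indices below \<open>n\<close>, so the sums up to \<open>n\<close> are the full
      stopped sums, to which \<open>mart\<close> applies.\<close>
    define n where "n = (LEAST n. \<not> \<bar>v (t n)\<bar> < \<epsilon>)"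
    have n: "\<not> \<bar>v (t n)\<bar> < \<epsilon>" "n \<le> J"
      unfolding n_def using LeastI[of "\<lambda>n. \<not> \<bar>v (t n)\<bar> < \<epsilon>", OF i] order_trans[OF Least_le[of "\<lambda>n. \<not> \<bar>v (t n)\<bar> < \<epsilon>", OF i] that] by blast+
    have less: "\<bar>v (t j)\<bar> < \<epsilon>" if "j < n" for j
      using not_less_Least[OF that[unfolded n_def]] by blast
    have \<phi>: "\<phi> j \<longleftrightarrow> j < n" for j
      unfolding \<phi>_def using n(1) less by (meson le_less_trans not_le)
    have cut: "(\<Sum>j<n. p j) = (\<Sum>j<J. if \<phi> j then p j else 0)" for p :: "nat \<Rightarrow> real"
      using n(2) by (intro sum.mono_neutral_cong_left) (auto simp: \<phi>)
    have "ln ((v (t n))\<^sup>2 + \<delta>) \<le> ln ((v (t 0))\<^sup>2 + \<delta>) + real n * (\<kappa> * h + 2 * (C * h)\<^sup>2 / \<delta>)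
      + (\<Sum>i<n. 2 * v (t i) / ((v (t i))\<^sup>2 + \<delta>) * (I (t (Suc i)) - I (t i)))
      + 2 * (\<Sum>i<n. (1 / sqrt ((v (t i))\<^sup>2 + \<delta>) * (I (t (Suc i)) - I (t i)))\<^sup>2)"
    proof (rule ln_square_grid_bound[OF \<delta>(1), where e="\<lambda>i. D (t (Suc i)) - D (t i)"])
      fix i assume i: "i < n"
      then have iJ: "i < J" using n(2) by simp
      show "v (t (Suc i)) - v (t i) = D (t (Suc i)) - D (t i) + (I (t (Suc i)) - I (t i))"
        using v[OF tT, of i] v[OF tT, of "Suc i"] iJ by simp
      show "2 * v (t i) * (D (t (Suc i)) - D (t i)) \<le> \<kappa> * h * ((v (t i))\<^sup>2 + \<delta>)"
        "\<bar>D (t (Suc i)) - D (t i)\<bar> \<le> C * h"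
        using step[OF iJ less[OF i]] by auto
    qed
    also have "(\<Sum>i<n. 2 * v (t i) / ((v (t i))\<^sup>2 + \<delta>) * (I (t (Suc i)) - I (t i))) \<le> K"
      unfolding cut using mart(1) by (simp add: if_distrib[of "\<lambda>x. x * _"] cong: if_cong)
    also have "(\<Sum>i<n. (1 / sqrt ((v (t i))\<^sup>2 + \<delta>) * (I (t (Suc i)) - I (t i)))\<^sup>2) \<le> K"
    proof -
      have "(if \<phi> i then (1 / sqrt ((v (t i))\<^sup>2 + \<delta>) * (I (t (Suc i)) - I (t i)))\<^sup>2 else 0)
        = ((if \<phi> i then 1 / sqrt ((v (t i))\<^sup>2 + \<delta>) else 0) * (I (t (Suc i)) - I (t i)))\<^sup>2" for i
        by simp
      then show ?thesis unfolding cut using mart(2) by simp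
    qed
    \<comment> \<open>With \<open>h = T / J\<close>, the quadratic drift error of all
      \<open>J\<close> steps is \<open>2 * (C * T)^2 / (J * \<delta>)\<close>.\<close>
    also have "real n * (\<kappa> * h + 2 * (C * h)\<^sup>2 / \<delta>) \<le> \<kappa> * T + 1"
    proof -
      have "0 \<le> \<kappa> * h + 2 * (C * h)\<^sup>2 / \<delta>" using L C h(1) \<delta>(1) by (auto simp: \<kappa>_def)
      then have "real n * (\<kappa> * h + 2 * (C * h)\<^sup>2 / \<delta>) \<le> real J * (\<kappa> * h + 2 * (C * h)\<^sup>2 / \<delta>)"
        using n(2) by (intro mult_right_mono) auto
      also have "\<dots> = \<kappa> * T + 2 * (C * T)\<^sup>2 / (real J * \<delta>)"
        using J \<delta>(1) by (simp add: h_def field_simps power2_eq_square)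
      also have "2 * (C * T)\<^sup>2 / (real J * \<delta>) \<le> 1"
        using fine J \<delta>(1) by (simp add: divide_le_eq_1)
      finally show ?thesis by simp
    qed
    \<comment> \<open>\<open>v 0 = I 0\<close>, as the drift integral over a single point vanishes;
      then \<delta>^2 \<le> \<delta> bounds the start value by \<open>2 * \<delta>\<close>.\<close>
    also have "ln ((v (t 0))\<^sup>2 + \<delta>) \<le> ln (2 * \<delta>)"
    proof -
      have "AE r in lborel. indicat_real {0..0} r *\<^sub>R f (u r) = 0"
        using AE_lborel_singleton[of "0::real"] by eventually_elim simp
      then have "D 0 = 0" unfolding D_def set_lebesgue_integral_def by (rule integral_eq_zero_AE)
      then have "\<bar>v (t 0)\<bar> \<le> \<delta>" using v[of 0] T I0 by (simp add: t0)
      then have "(v (t 0))\<^sup>2 \<le> \<delta>\<^sup>2" using power_mono[OF _ abs_ge_zero, of "v (t 0)" \<delta> 2] by simp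
      also have "\<delta>\<^sup>2 \<le> \<delta>" using \<delta> by (simp add: power2_eq_square mult_left_le)
      finally show ?thesis using \<delta>(1) by (intro ln_mono) (auto intro: add_nonneg_pos)
    qed
    finally have "ln ((v (t n))\<^sup>2 + \<delta>) \<le> ln (2 * \<delta>) + (\<kappa> * T + 1 + 3 * K)" by simp
    also have "\<dots> = ln (2 * \<delta> * exp (\<kappa> * T + 1 + 3 * K))" using \<delta>(1) by (simp add: ln_mult)
    finally have "(v (t n))\<^sup>2 + \<delta> \<le> 2 * \<delta> * exp (\<kappa> * T + 1 + 3 * K)"
      using \<delta>(1) by (subst (asm) ln_le_cancel_iff) (auto intro: add_nonneg_pos)
    \<comment> \<open>The summand \<delta> on the left makes the inequality strict, against |v|
      \<ge> \<epsilon> at the exit.\<close>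
    then have "(v (t n))\<^sup>2 < \<epsilon>\<^sup>2" using small \<delta>(1) by linarith
    moreover have "\<epsilon>\<^sup>2 \<le> (v (t n))\<^sup>2"
      using n(1) \<delta> power_mono[of \<epsilon> "\<bar>v (t n)\<bar>" 2] by simp
    ultimately show False by simp
  qed
  \<comment> \<open>The cell index is the integer part of \<open>s / h\<close>, except at
    \<open>s = T\<close>, where this would be \<open>J\<close>.\<close>
  obtain i where i: "i < J" "s \<in> {t i..t (Suc i)}"
  proof (cases "s = T")
    case True
    then have "s \<in> {t (J - 1)..t (Suc (J - 1))}" using t_mono[of "J - 1" J] t0 J by simp
    then show ?thesis using that[of "J - 1"] J by simp
  next
    case False
    define i where "i = nat \<lfloor>s / h\<rfloor>"
    have sh: "0 \<le> s / h" using s h(1) by simp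
    have fl: "real i \<le> s / h" "s / h < real i + 1"
      using sh unfolding i_def by (auto simp: of_nat_nat of_int_floor_le)
    have th: "t j = real j * h" for j by (simp add: t_def h_def)
    have "s < real J * h" using s False J by (simp add: h_def)
    then have "s / h < real J" using h(1) by (simp add: field_simps)
    then have "i < J" using fl(1) by linarith
    moreover have "s \<in> {t i..t (Suc i)}"
      using fl h(1) by (simp add: th field_simps)
    ultimately show ?thesis by (rule that)
  qed
  show ?thesis
    using near[OF i] in_band[of i] i(1) \<delta> by auto
qed

section \<open>Convergence of the solutions\<close>

text \<open>With \<open>y = g (U s)\<close> and \<open>x\<close> the value of \<open>V\<close> at
  the left end of the cell, the bound on \<open>y^2\<close> cancels the denominators uniformly in
  \<delta>. The second weight would allow \<open>8 * L^2\<close>; the common constant lets one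
  argument serve both.\<close>

lemma weighted_square_bounds:
  fixes x \<delta> y L :: real
  assumes \<delta>: "0 < \<delta>" and y: "y\<^sup>2 \<le> L\<^sup>2 * (8 * (x\<^sup>2 + \<delta>))"
  shows "(2 * x / (x\<^sup>2 + \<delta>) * y)\<^sup>2 \<le> 32 * L\<^sup>2" and "(1 / sqrt (x\<^sup>2 + \<delta>) * y)\<^sup>2 \<le> 32 * L\<^sup>2"
proof -
  define q where "q = x\<^sup>2 + \<delta>"
  have q: "0 < q" "x\<^sup>2 \<le> q" using \<delta> by (auto simp: q_def intro: add_nonneg_pos)
  have y: "y\<^sup>2 \<le> 8 * L\<^sup>2 * q" using y unfolding q_def by (simp only: mult_ac)
  have "x\<^sup>2 * y\<^sup>2 \<le> q * (8 * L\<^sup>2 * q)" using q y by (intro mult_mono) auto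
  then show "(2 * x / (x\<^sup>2 + \<delta>) * y)\<^sup>2 \<le> 32 * L\<^sup>2"
    using q(1) unfolding q_def[symmetric]
    by (simp add: power_mult_distrib power_divide pos_divide_le_eq power2_eq_square[of q] mult_ac)
  have "8 * L\<^sup>2 * q \<le> 32 * L\<^sup>2 * q" using q(1) by (intro mult_right_mono) auto
  with y have "y\<^sup>2 \<le> 32 * L\<^sup>2 * q" by (rule order_trans)
  then show "(1 / sqrt (x\<^sup>2 + \<delta>) * y)\<^sup>2 \<le> 32 * L\<^sup>2"
    using q(1) unfolding q_def[symmetric]
    by (simp add: power_mult_distrib power_divide pos_divide_le_eq)
qed

lemma continuous_on_set_integral_Icc:
  fixes \<phi> :: "real \<Rightarrow> real"
  assumes "set_integrable lborel {0..T} \<phi>"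
  shows "continuous_on {0..T} (\<lambda>s. LINT r:{0..s}|lborel. \<phi> r)"
proof -
  have "continuous_on {0..T} (\<lambda>s. integral {0..s} \<phi>)"
    by (intro indefinite_integral_continuous_1 set_borel_integral_eq_integral(1) assms)
  moreover have "(LINT r:{0..s}|lborel. \<phi> r) = integral {0..s} \<phi>" if "s \<in> {0..T}" for s
    using that by (intro set_borel_integral_eq_integral(2) set_integrable_subset[OF assms]) auto
  ultimately show ?thesis by (auto intro: continuous_on_eq)
qed

context usual_filtered_prob_space
begin

text \<open>The grid is chosen inside the proof and leaves no trace in the bound. Each of the two
  stochastic sums contributes \<open>24 * 32 * L^2 = 768 * L^2\<close>, times \<open>T / K\<close>.
  The event that \<open>A\<close> is large counts three times: directly and once for each stochastic
  sum.\<close>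

lemma solution_tail:
  assumes W: "brownian_motion M F T W" and A: "adapted F T A"
    and sde: "solves_sde M F T W f g A U"
    and f: "\<And>x. x * f x \<le> L * x\<^sup>2" "\<And>x. \<bar>x\<bar> \<le> 3 \<Longrightarrow> \<bar>f x\<bar> \<le> C"
    and g: "\<And>x. \<bar>g x\<bar> \<le> L * \<bar>x\<bar>"
    and L: "0 < L" and C: "0 \<le> C"
    and \<delta>: "0 < \<delta>" "\<delta> \<le> \<epsilon>" "\<epsilon> \<le> 1" and K: "1 \<le> K"
    and small: "2 * \<delta> * exp ((16 * L + 4 * C) * T + 1 + 3 * K) \<le> \<epsilon>\<^sup>2"
  shows "outer_measure_of M {\<omega> \<in> space M. ennreal (3 * \<epsilon>) < sup_norm T U \<omega>}
    \<le> 3 * outer_measure_of M {\<omega> \<in> space M. ennreal \<delta> < sup_norm T A \<omega>} + ennreal (1536 * L\<^sup>2 * T / K)"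
proof (rule ennreal_le_epsilon)
  fix \<eta> :: real assume \<eta>: "0 < \<eta>"
  obtain I where I: "ito_integral M F T W (\<lambda>s \<omega>. g (U s \<omega>)) I"
    and eq: "AE \<omega> in M. \<forall>t\<in>{0..T}. U t \<omega> = A t \<omega> + (LINT s:{0..t}|lborel. f (U s \<omega>)) + I t \<omega>"
    and int: "AE \<omega> in M. set_integrable lborel {0..T} (\<lambda>s. f (U s \<omega>))"
    and U: "adapted F T U"
    using sde by (auto simp: solves_sde_def)
  have contI: "AE \<omega> in M. continuous_on {0..T} (\<lambda>t. I t \<omega>)" using I by (simp add: ito_integral_def)
  define V where "V t \<omega> = U t \<omega> - A t \<omega>" for t \<omega>
  have VF: "V t \<in> borel_measurable (F t)" if "t \<in> {0..T}" for t
    using U A that unfolding V_def adapted_def by (intro borel_measurable_diff) auto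
  have VM: "V t \<in> borel_measurable M" if "t \<in> {0..T}" for t
    by (rule measurable_F_M[OF VF[OF that] that])
  \<comment> \<open>\<open>V\<close> is drift plus stochastic integral, hence continuous, whatever
    the paths of \<open>A\<close> look like.\<close>
  have contV: "AE \<omega> in M. continuous_on {0..T} (\<lambda>t. V t \<omega>)"
    using eq int contI
  proof eventually_elim
    fix \<omega> assume e: "\<forall>t\<in>{0..T}. U t \<omega> = A t \<omega> + (LINT s:{0..t}|lborel. f (U s \<omega>)) + I t \<omega>"
      and i: "set_integrable lborel {0..T} (\<lambda>s. f (U s \<omega>))" and c: "continuous_on {0..T} (\<lambda>t. I t \<omega>)"
    have "continuous_on {0..T} (\<lambda>t. (LINT s:{0..t}|lborel. f (U s \<omega>)) + I t \<omega>)"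
      by (intro continuous_on_add continuous_on_set_integral_Icc i c)
    then show "continuous_on {0..T} (\<lambda>t. V t \<omega>)"
      by (rule continuous_on_eq) (use e in \<open>simp add: V_def\<close>)
  qed
  define t where "t J i = real i * T / real J" for J i :: nat
  define Osc where "Osc J = {\<omega> \<in> space M. \<exists>i<J. \<exists>s\<in>{t J i..t J (Suc i)}. \<delta> < \<bar>V s \<omega> - V (t J i) \<omega>\<bar>}" for J
  have "(\<lambda>J. outer_measure_of M (Osc J)) \<longlonglongrightarrow> 0"
    unfolding Osc_def t_def by (rule grid_oscillation_tendsto_0[OF VM contV horizon_pos \<delta>(1)])
  \<comment> \<open>A third of \<eta>, because the oscillation event will be counted three
    times.\<close>
  then have "\<forall>\<^sub>F J in sequentially. outer_measure_of M (Osc J) \<le> ennreal (\<eta> / 3)"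
    using \<eta> by (simp add: tendsto_ennreal_0_iff)
  moreover have "\<forall>\<^sub>F J in sequentially. 2 * (C * T)\<^sup>2 / \<delta> \<le> real J"
    by (rule eventually_at_top_linorder[THEN iffD2])
      (metis of_nat_le_iff order_trans real_arch_simple)
  ultimately have "\<forall>\<^sub>F J in sequentially. outer_measure_of M (Osc J) \<le> ennreal (\<eta> / 3)
      \<and> 2 * (C * T)\<^sup>2 / \<delta> \<le> real J \<and> 0 < J"
    by (intro eventually_conj eventually_gt_at_top)
  then obtain J where J: "outer_measure_of M (Osc J) \<le> ennreal (\<eta> / 3)"
      "2 * (C * T)\<^sup>2 / \<delta> \<le> real J" "0 < J"
    by (auto simp: eventually_sequentially)
  note t = t_def[of J]
  have t0: "0 \<le> t J 0" "t J J \<le> T" using J(3) by (auto simp: t)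
  have t_mono: "t J i \<le> t J j" if "i \<le> j" for i j
    using that horizon_pos unfolding t by (intro divide_right_mono mult_right_mono) auto
  have tT: "t J i \<in> {0..T}" if "i \<le> J" for i
    using t_mono[of 0 i] t_mono[OF that] t0 by auto
  define Big where "Big = {\<omega> \<in> space M. ennreal \<delta> < sup_norm T A \<omega>}"
  \<comment> \<open>Off \<open>G\<close>, every \<open>U s\<close> stays within
    \<open>2 * \<delta>\<close> of \<open>V\<close> at the left end of the cell of
    \<open>s\<close>.\<close>
  define G where "G = Big \<union> Osc J"
  have Gspace: "Big \<subseteq> space M" "Osc J \<subseteq> space M" "G \<subseteq> space M"
    unfolding G_def Big_def Osc_def by auto
  have A_le: "\<bar>A s \<omega>\<bar> \<le> \<delta>" if "\<omega> \<in> space M" "\<omega> \<notin> G" "s \<in> {0..T}" for s \<omega>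
    using that \<delta>(1) by (intro not_less_sup_normD[where X=A]) (auto simp: G_def Big_def)
  have osc: "\<bar>V s \<omega> - V (t J i) \<omega>\<bar> \<le> \<delta>"
    if "\<omega> \<in> space M" "\<omega> \<notin> G" "i < J" "s \<in> {t J i..t J (Suc i)}" for s i \<omega>
  proof (rule ccontr)
    assume "\<not> \<bar>V s \<omega> - V (t J i) \<omega>\<bar> \<le> \<delta>"
    then have "\<delta> < \<bar>V s \<omega> - V (t J i) \<omega>\<bar>" by simp
    then have "\<omega> \<in> Osc J" unfolding Osc_def using that(1,3,4) by blast
    then show False using that(2) by (simp add: G_def)
  qed
  have gU: "(g (U s \<omega>))\<^sup>2 \<le> L\<^sup>2 * (8 * ((V (t J i) \<omega>)\<^sup>2 + \<delta>))"
    if "\<omega> \<in> space M" "\<omega> \<notin> G" "i < J" "s \<in> {t J i<..t J (Suc i)}" for s i \<omega>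
  proof -
    have "s \<in> {0..T}" using tT[of i] tT[of "Suc i"] that(3,4) by auto
    from A_le[OF that(1,2) this] osc[OF that(1-3), of s] that(4)
    have "\<bar>U s \<omega> - V (t J i) \<omega>\<bar> \<le> 2 * \<delta>" unfolding V_def[of s] by auto
    then have "(U s \<omega>)\<^sup>2 \<le> 8 * ((V (t J i) \<omega>)\<^sup>2 + \<delta>)" using \<delta> by (intro square_le_near) auto
    moreover have "(g (U s \<omega>))\<^sup>2 \<le> L\<^sup>2 * (U s \<omega>)\<^sup>2"
      using power_mono[OF g[of "U s \<omega>"] abs_ge_zero, of 2] by (simp add: power_mult_distrib)
    ultimately show ?thesis by (meson mult_left_mono order_trans zero_le_power2)
  qed
  \<comment> \<open>\<open>\<psi>\<close> will be \<open>2 * x / (x^2 + \<delta>)\<close>, the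
    derivative of the logarithm, and \<open>1 / sqrt (x^2 + \<delta>)\<close> for the squared
    increments. Its bound \<open>B\<close> may depend on \<delta>; the result does not.\<close>
  have stopped: "outer_measure_of M {\<omega> \<in> space M.
      K < (\<Sum>i<J. (if \<forall>j\<le>i. \<bar>V (t J j) \<omega>\<bar> < \<epsilon> then \<psi> (V (t J i) \<omega>) else 0) * (I (t J (Suc i)) \<omega> - I (t J i) \<omega>))\<^sup>2
        + (\<Sum>i<J. ((if \<forall>j\<le>i. \<bar>V (t J j) \<omega>\<bar> < \<epsilon> then \<psi> (V (t J i) \<omega>) else 0) * (I (t J (Suc i)) \<omega> - I (t J i) \<omega>))\<^sup>2)}
    \<le> outer_measure_of M G + ennreal (768 * L\<^sup>2 * T / K)"
    if \<psi>: "\<psi> \<in> borel_measurable borel" "0 < B" "\<And>x. \<bar>x\<bar> < \<epsilon> \<Longrightarrow> \<bar>\<psi> x\<bar> \<le> B"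
      "\<And>x y. y\<^sup>2 \<le> L\<^sup>2 * (8 * (x\<^sup>2 + \<delta>)) \<Longrightarrow> (\<psi> x * y)\<^sup>2 \<le> 32 * L\<^sup>2"
    for \<psi> :: "real \<Rightarrow> real" and B :: real
  proof -
    define c where "c i \<omega> = (if \<forall>j\<le>i. \<bar>V (t J j) \<omega>\<bar> < \<epsilon> then \<psi> (V (t J i) \<omega>) else 0)" for i \<omega>
    have "outer_measure_of M {\<omega> \<in> space M.
      K < (\<Sum>i<J. c i \<omega> * (I (t J (Suc i)) \<omega> - I (t J i) \<omega>))\<^sup>2
        + (\<Sum>i<J. (c i \<omega> * (I (t J (Suc i)) \<omega> - I (t J i) \<omega>))\<^sup>2)}
      \<le> outer_measure_of M {\<omega> \<in> space M. \<exists>i<J. \<exists>s\<in>{t J i<..t J (Suc i)}. 32 * L\<^sup>2 < (c i \<omega> * g (U s \<omega>))\<^sup>2}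
        + ennreal (24 * (32 * L\<^sup>2) * T / K)"
    proof (rule ito_integral_grid_tail[OF W I])
      show "0 \<le> t J 0" "t J J \<le> T" by (fact t0)+
      show "t J i \<le> t J (Suc i)" for i by (rule t_mono) simp
      show "c i \<in> borel_measurable (F (t J i))" if "i < J" for i
        unfolding c_def
      proof (rule borel_measurable_stopped[where X="\<lambda>j. V (t J j)", OF _ \<psi>(1)])
        fix j assume "j \<le> i"
        then show "V (t J j) \<in> borel_measurable (F (t J i))"
          using that tT[of i] tT[of j] t_mono[of j i] by (intro measurable_F_mono[OF VF]) auto
      qed
      show "\<bar>c i \<omega>\<bar> \<le> B" if "i < J" "\<omega> \<in> space M" for i \<omega>
        using \<psi>(2) \<psi>(3)[of "V (t J i) \<omega>"] by (auto simp: c_def)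
      show "0 < B" by (rule \<psi>(2))
      show "0 < K" "0 < 32 * L\<^sup>2" using K L by auto
    qed
    also have "\<dots> \<le> outer_measure_of M G + ennreal (24 * (32 * L\<^sup>2) * T / K)"
    proof (intro add_right_mono outer_measure_of_mono subsetI)
      fix \<omega> assume "\<omega> \<in> {\<omega> \<in> space M. \<exists>i<J. \<exists>s\<in>{t J i<..t J (Suc i)}. 32 * L\<^sup>2 < (c i \<omega> * g (U s \<omega>))\<^sup>2}"
      then obtain i s where *: "\<omega> \<in> space M" "i < J" "s \<in> {t J i<..t J (Suc i)}"
        "32 * L\<^sup>2 < (c i \<omega> * g (U s \<omega>))\<^sup>2" by blast
      show "\<omega> \<in> G"
      proof (rule ccontr)
        assume "\<omega> \<notin> G"
        from \<psi>(4)[OF gU[OF *(1) this *(2,3)]] have "(c i \<omega> * g (U s \<omega>))\<^sup>2 \<le> 32 * L\<^sup>2"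
          by (simp add: c_def)
        then show False using *(4) by simp
      qed
    qed
    also have "24 * (32 * L\<^sup>2) = 768 * L\<^sup>2" by simp
    finally show ?thesis unfolding c_def .
  qed
  let ?d = "\<lambda>i \<omega>. I (t J (Suc i)) \<omega> - I (t J i) \<omega>"
  let ?c1 = "\<lambda>i \<omega>. if \<forall>j\<le>i. \<bar>V (t J j) \<omega>\<bar> < \<epsilon> then 2 * V (t J i) \<omega> / ((V (t J i) \<omega>)\<^sup>2 + \<delta>) else 0"
  let ?c2 = "\<lambda>i \<omega>. if \<forall>j\<le>i. \<bar>V (t J j) \<omega>\<bar> < \<epsilon> then 1 / sqrt ((V (t J i) \<omega>)\<^sup>2 + \<delta>) else 0"
  define X1 where "X1 = {\<omega> \<in> space M. K < (\<Sum>i<J. ?c1 i \<omega> * ?d i \<omega>)\<^sup>2 + (\<Sum>i<J. (?c1 i \<omega> * ?d i \<omega>)\<^sup>2)}"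
  define X2 where "X2 = {\<omega> \<in> space M. K < (\<Sum>i<J. ?c2 i \<omega> * ?d i \<omega>)\<^sup>2 + (\<Sum>i<J. (?c2 i \<omega> * ?d i \<omega>)\<^sup>2)}"
  have X1: "outer_measure_of M X1 \<le> outer_measure_of M G + ennreal (768 * L\<^sup>2 * T / K)"
    unfolding X1_def
  proof (rule stopped[of "\<lambda>x. 2 * x / (x\<^sup>2 + \<delta>)" "2 / \<delta>"])
    fix x :: real assume "\<bar>x\<bar> < \<epsilon>"
    \<comment> \<open>A crude bound, from |x| \<le> 1 and x^2 \<ge> 0; only its finiteness
      matters.\<close>
    then have "2 * \<bar>x\<bar> / (x\<^sup>2 + \<delta>) \<le> 2 / \<delta>" using \<delta> by (intro frac_le) auto
    then show "\<bar>2 * x / (x\<^sup>2 + \<delta>)\<bar> \<le> 2 / \<delta>" using \<delta>(1) by (simp add: abs_mult)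
  qed (use \<delta>(1) weighted_square_bounds(1)[OF \<delta>(1)] in \<open>measurable, auto\<close>)
  have X2: "outer_measure_of M X2 \<le> outer_measure_of M G + ennreal (768 * L\<^sup>2 * T / K)"
    unfolding X2_def
  proof (rule stopped[of "\<lambda>x. 1 / sqrt (x\<^sup>2 + \<delta>)" "1 / sqrt \<delta>"])
    fix x :: real
    have "1 / sqrt (x\<^sup>2 + \<delta>) \<le> 1 / sqrt \<delta>" using \<delta> by (intro frac_le) auto
    then show "\<bar>1 / sqrt (x\<^sup>2 + \<delta>)\<bar> \<le> 1 / sqrt \<delta>" using \<delta>(1) by simp
  qed (use \<delta>(1) weighted_square_bounds(2)[OF \<delta>(1)] in \<open>measurable, auto\<close>)
  have "outer_measure_of M {\<omega> \<in> space M. ennreal (3 * \<epsilon>) < sup_norm T U \<omega>} \<le> outer_measure_of M (G \<union> (X1 \<union> X2))"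
  proof (rule outer_measure_of_mono_AE)
    show "AE \<omega> in M. \<omega> \<in> {\<omega> \<in> space M. ennreal (3 * \<epsilon>) < sup_norm T U \<omega>} \<longrightarrow> \<omega> \<in> G \<union> (X1 \<union> X2)"
      using eq int ito_integral_at_0[OF I \<delta>(1)]
    proof eventually_elim
      fix \<omega>
      assume e: "\<forall>t\<in>{0..T}. U t \<omega> = A t \<omega> + (LINT s:{0..t}|lborel. f (U s \<omega>)) + I t \<omega>"
        and i: "set_integrable lborel {0..T} (\<lambda>s. f (U s \<omega>))" and I0: "\<bar>I 0 \<omega>\<bar> \<le> \<delta>"
      show "\<omega> \<in> {\<omega> \<in> space M. ennreal (3 * \<epsilon>) < sup_norm T U \<omega>} \<longrightarrow> \<omega> \<in> G \<union> (X1 \<union> X2)"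
      proof (rule impI, rule ccontr)
        assume "\<omega> \<in> {\<omega> \<in> space M. ennreal (3 * \<epsilon>) < sup_norm T U \<omega>}"
        then obtain s where \<omega>: "\<omega> \<in> space M" and s: "s \<in> {0..T}" "3 * \<epsilon> < \<bar>U s \<omega>\<bar>"
          using \<delta> by (auto simp: sup_norm_less_iff ennreal_less_iff)
        assume "\<omega> \<notin> G \<union> (X1 \<union> X2)"
        then have G: "\<omega> \<notin> G" and n1: "\<omega> \<notin> X1" and n2: "\<omega> \<notin> X2" by auto
        have nonneg: "0 \<le> (\<Sum>i<J. (?c1 i \<omega> * ?d i \<omega>)\<^sup>2)" "0 \<le> (\<Sum>i<J. ?c2 i \<omega> * ?d i \<omega>)\<^sup>2"
          by (auto intro: sum_nonneg)
        have "\<not> K < (\<Sum>i<J. ?c1 i \<omega> * ?d i \<omega>)\<^sup>2 + (\<Sum>i<J. (?c1 i \<omega> * ?d i \<omega>)\<^sup>2)"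
          using n1 \<omega> unfolding X1_def by blast
        then have "(\<Sum>i<J. ?c1 i \<omega> * ?d i \<omega>)\<^sup>2 \<le> K" using nonneg(1) by linarith
        \<comment> \<open>For \<open>1 \<le> K\<close>, a square bounded by \<open>K\<close> has a
          root bounded by \<open>K\<close>, so one constant serves both conditions in
          \<open>mart\<close>.\<close>
        also have "K \<le> K\<^sup>2" using K by (simp add: self_le_power)
        finally have m1: "(\<Sum>i<J. ?c1 i \<omega> * ?d i \<omega>) \<le> K" by (rule power2_le_imp_le) (use K in simp)
        have "\<not> K < (\<Sum>i<J. ?c2 i \<omega> * ?d i \<omega>)\<^sup>2 + (\<Sum>i<J. (?c2 i \<omega> * ?d i \<omega>)\<^sup>2)"
          using n2 \<omega> unfolding X2_def by blast
        then have m2: "(\<Sum>i<J. (?c2 i \<omega> * ?d i \<omega>)\<^sup>2) \<le> K" using nonneg(2) by linarith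
        have "\<bar>U s \<omega>\<bar> \<le> 3 * \<epsilon>"
        proof (rule grid_solution_bound[OF horizon_pos J(3) L C f, where a="\<lambda>s. A s \<omega>" and u="\<lambda>s. U s \<omega>"
              and I="\<lambda>s. I s \<omega>", folded t V_def])
          show "U s \<omega> = A s \<omega> + (LINT r:{0..s}|lborel. f (U r \<omega>)) + I s \<omega>" if "s \<in> {0..T}" for s
            using e that by blast
          show "2 * (C * T)\<^sup>2 \<le> real J * \<delta>" using J(2) \<delta>(1) by (simp add: pos_divide_le_eq)
        qed (assumption | rule i I0 A_le[OF \<omega> G] osc[OF \<omega> G] \<delta> m1 m2 small s(1))+
        then show False using s(2) by simp
      qed
    qed
  qed (use Gspace in \<open>auto simp: X1_def X2_def\<close>)
  also have "\<dots> \<le> outer_measure_of M G + outer_measure_of M (X1 \<union> X2)"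
    using Gspace by (intro outer_measure_of_union_le) (auto simp: X1_def X2_def)
  also have "\<dots> \<le> outer_measure_of M G + (outer_measure_of M X1 + outer_measure_of M X2)"
    by (intro add_left_mono outer_measure_of_union_le) (auto simp: X1_def X2_def)
  also have "\<dots> \<le> outer_measure_of M G + ((outer_measure_of M G + ennreal (768 * L\<^sup>2 * T / K))
      + (outer_measure_of M G + ennreal (768 * L\<^sup>2 * T / K)))"
    by (intro add_left_mono add_mono X1 X2)
  also have "\<dots> = 3 * outer_measure_of M G + (ennreal (768 * L\<^sup>2 * T / K) + ennreal (768 * L\<^sup>2 * T / K))"
  proof -
    have "3 * x = x + (x + x)" for x :: ennreal
    proof -
      have "3 * x = (1 + (1 + 1)) * x" by simp
      also have "\<dots> = x + (x + x)" by (simp only: distrib_right mult_1_left)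
      finally show ?thesis .
    qed
    then show ?thesis by (simp only: add_ac)
  qed
  also have "ennreal (768 * L\<^sup>2 * T / K) + ennreal (768 * L\<^sup>2 * T / K) = ennreal (1536 * L\<^sup>2 * T / K)"
    using K horizon_pos by (simp add: ennreal_plus[symmetric] del: ennreal_plus)
  also have "3 * outer_measure_of M G + ennreal (1536 * L\<^sup>2 * T / K)
      \<le> 3 * (outer_measure_of M Big + ennreal (\<eta> / 3)) + ennreal (1536 * L\<^sup>2 * T / K)"
    using Gspace by (intro add_right_mono mult_left_mono order_trans[OF outer_measure_of_union_le[of G Big "Osc J"]] add_left_mono J(1))
      (auto simp: G_def)
  also have "3 * (outer_measure_of M Big + ennreal (\<eta> / 3)) = 3 * outer_measure_of M Big + ennreal \<eta>"
  proof -
    have "3 * ennreal (\<eta> / 3) = ennreal (3 * (\<eta> / 3))" using \<eta> by (subst ennreal_mult) auto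
    then show ?thesis by (simp add: distrib_left)
  qed
  finally show "outer_measure_of M {\<omega> \<in> space M. ennreal (3 * \<epsilon>) < sup_norm T U \<omega>}
    \<le> 3 * outer_measure_of M {\<omega> \<in> space M. ennreal \<delta> < sup_norm T A \<omega>}
      + ennreal (1536 * L\<^sup>2 * T / K) + ennreal \<eta>"
    unfolding Big_def by (simp only: ac_simps)
qed

end

theorem proposition2p6:
  fixes M :: "'a measure" and F :: "real \<Rightarrow> 'a measure" and T L :: real
    and W :: "real \<Rightarrow> 'a \<Rightarrow> real"
    and A U :: "nat \<Rightarrow> real \<Rightarrow> 'a \<Rightarrow> real"
    and f g :: "real \<Rightarrow> real"
  assumes "usual_filtered_prob_space M F T"
    and "brownian_motion M F T W"
    and "\<And>n. adapted F T (A n)"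
    and "tends_to_0_in_prob M (\<lambda>n. sup_norm T (A n))"
    and "f 0 = 0" and "g 0 = 0"
    and "L > 0"
    and "\<And>x y. (x - y) * (f x - f y) \<le> L * \<bar>x - y\<bar>\<^sup>2"
    and "\<And>x y. \<bar>g x - g y\<bar> \<le> L * \<bar>x - y\<bar>"
    and "\<And>n. solves_sde M F T W f g (A n) (U n)"
  shows "tends_to_0_in_prob M (\<lambda>n. sup_norm T (U n))"
  unfolding tends_to_0_in_prob_def tendsto_ennreal_0_iff
proof (intro allI impI)
  fix \<epsilon>' \<eta> :: real assume \<epsilon>': "0 < \<epsilon>'" and \<eta>: "0 < \<eta>"
  interpret usual_filtered_prob_space M F T by fact
  obtain C where C: "0 \<le> C" "\<And>x. \<bar>x\<bar> \<le> 3 \<Longrightarrow> \<bar>f x\<bar> \<le> C"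
    using one_sided_Lipschitz_locally_bounded[OF assms(8)] by blast
  have f: "x * f x \<le> L * x\<^sup>2" for x using assms(8)[of x 0] assms(5) by simp
  have g: "\<bar>g x\<bar> \<le> L * \<bar>x\<bar>" for x using assms(9)[of x 0] assms(6) by simp
  \<comment> \<open>The cap at 1 keeps the solution where \<open>C\<close> bounds \<open>f\<close>.
    \<open>K\<close> makes the stochastic part at most \<eta> / 2 and involves neither \<epsilon>
    nor \<delta>. Hence \<open>E\<close> is fixed before \<delta>, which is chosen last to give
    \<open>2 * \<delta> * E \<le> \<epsilon>^2\<close>.\<close>
  define \<epsilon> where "\<epsilon> = min (\<epsilon>' / 3) 1"
  define K where "K = max 1 (1536 * L\<^sup>2 * T / (\<eta> / 2))"
  define E where "E = exp ((16 * L + 4 * C) * T + 1 + 3 * K)"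
  define \<delta> where "\<delta> = min \<epsilon> (\<epsilon>\<^sup>2 / (2 * E))"
  have \<epsilon>: "0 < \<epsilon>" "\<epsilon> \<le> 1" "3 * \<epsilon> \<le> \<epsilon>'" using \<epsilon>' by (auto simp: \<epsilon>_def)
  have E: "0 < E" by (simp add: E_def)
  have \<delta>: "0 < \<delta>" "\<delta> \<le> \<epsilon>" using \<epsilon> E by (auto simp: \<delta>_def)
  have "\<delta> \<le> \<epsilon>\<^sup>2 / (2 * E)" by (simp add: \<delta>_def)
  then have small: "2 * \<delta> * E \<le> \<epsilon>\<^sup>2" using E by (simp add: pos_le_divide_eq mult_ac)
  have K: "1 \<le> K" "1536 * L\<^sup>2 * T / K \<le> \<eta> / 2"
  proof -
    show "1 \<le> K" by (simp add: K_def)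
    have "1536 * L\<^sup>2 * T / (\<eta> / 2) \<le> K" unfolding K_def by (rule max.cobounded2)
    then have "1536 * L\<^sup>2 * T \<le> K * (\<eta> / 2)" using \<eta> by (subst (asm) pos_divide_le_eq) auto
    then show "1536 * L\<^sup>2 * T / K \<le> \<eta> / 2" using \<open>1 \<le> K\<close> by (simp add: pos_divide_le_eq mult.commute)
  qed
  \<comment> \<open>A sixth of \<eta>, counted three times in the tail estimate, is the remaining
    half.\<close>
  have "\<forall>\<^sub>F n in sequentially. outer_measure_of M {\<omega> \<in> space M. ennreal \<delta> < sup_norm T (A n) \<omega>} \<le> ennreal (\<eta> / 6)"
    using \<eta> by (intro tends_to_0_in_probD[OF assms(4) \<delta>(1)]) auto
  then show "\<forall>\<^sub>F n in sequentially. outer_measure_of M {\<omega> \<in> space M. ennreal \<epsilon>' < sup_norm T (U n) \<omega>} \<le> ennreal \<eta>"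
  proof eventually_elim
    case (elim n)
    have "outer_measure_of M {\<omega> \<in> space M. ennreal \<epsilon>' < sup_norm T (U n) \<omega>}
        \<le> outer_measure_of M {\<omega> \<in> space M. ennreal (3 * \<epsilon>) < sup_norm T (U n) \<omega>}"
      using \<epsilon>(3) by (intro outer_measure_of_mono) (auto elim!: le_less_trans[rotated] intro: ennreal_leI)
    also have "\<dots> \<le> 3 * outer_measure_of M {\<omega> \<in> space M. ennreal \<delta> < sup_norm T (A n) \<omega>}
        + ennreal (1536 * L\<^sup>2 * T / K)"
      by (rule solution_tail[OF assms(2,3,10) f C(2) g assms(7) C(1) \<delta> \<epsilon>(2) K(1) small[unfolded E_def]])
    also have "\<dots> \<le> 3 * ennreal (\<eta> / 6) + ennreal (\<eta> / 2)"
      by (intro add_mono mult_left_mono elim ennreal_leI K(2)) auto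
    also have "3 * ennreal (\<eta> / 6) = ennreal (3 * (\<eta> / 6))" using \<eta> by (subst ennreal_mult) auto
    also have "ennreal (3 * (\<eta> / 6)) + ennreal (\<eta> / 2) = ennreal \<eta>"
      using \<eta> by (simp add: ennreal_plus[symmetric] del: ennreal_plus)
    finally show ?case .
  qed
qed

end
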